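(* The internal tensor product $(M,N)\mapsto M\otimes_{\mathbb Z_\bullet}N$ endows the category of (left) $\mathbb M$-modules with an additive closed symmetric monoidal structure with $\mathbb Z_\bullet$ as unit.
   Context: $\mathbb N=\{0,1,2,\dots\}$. $\mathbb M$ is the ring of column-finite matrices $[c_{kn}]_{k,n\in\mathbb N}$ with integer coefficients (for each $n$, $c_{kn}=0$ for all but finitely many $k$), with usual matrix addition and multiplication. "Module" means left module. $\mathbb Z_\bullet=\bigoplus_{\mathbb N}\mathbb Z$ is the abelian group of finite column vectors, with its left $\mathbb M$-module structure given by matrix multiplication. $\mathbb M^{\otimes 2}$ denotes the abelian group of families $[c_{ijk}]_{i,j,k\in\mathbb N}$ of integers such that for all $j,k$ one has $c_{ijk}=0$ for all but finitely many $i$. It is a left $\mathbb M$-module by $(u\cdot c)_{ijk}=\sum_l u_{il}c_{ljk}$ and has two commuting right $\mathbb M$-module structures $(c\cdot_1u)_{ijk}=\sum_l c_{ilk}u_{lj}$ and $(c\cdot_2u)_{ijk}=\sum_l c_{ijl}u_{lk}$. The internal tensor product of two $\mathbb M$-modules $M,N$ is the $\mathbb M$-module $M\otimes_{\mathbb Z_\bullet}N:=(\mathbb M^{\otimes 2}\otimes_{\mathbb M}M)\otimes_{\mathbb M}N$, using successively the two right structures on $\mathbb M^{\otimes 2}$. *)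

theory Defs
  imports "HOL-Algebra.Module" "HOL-Algebra.Generated_Groups" "HOL-Algebra.Free_Abelian_Groups"
    "HOL-Library.Nat_Bijection"
begin

section \<open>Left modules over a ring that need not be commutative\<close>

text \<open>
  The locale below is \<^locale>\<open>module\<close> with \<^locale>\<open>cring\<close> weakened to \<^locale>\<open>ring\<close>. As there,
  the fields \<^term>\<open>monoid.mult\<close> and \<^term>\<open>monoid.one\<close> of the record carrying the module
  have no meaning.
\<close>

locale left_module = R?: ring R + M?: abelian_group M
  for R :: "('a, 'k) ring_scheme" (structure) and M :: "('a, 'm) module" (structure) +
  assumes smult_closed:
      "\<lbrakk>a \<in> carrier R; x \<in> carrier M\<rbrakk> \<Longrightarrow> a \<odot>\<^bsub>M\<^esub> x \<in> carrier M"
    and smult_l_distr: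
      "\<lbrakk>a \<in> carrier R; b \<in> carrier R; x \<in> carrier M\<rbrakk> \<Longrightarrow>
        (a \<oplus>\<^bsub>R\<^esub> b) \<odot>\<^bsub>M\<^esub> x = a \<odot>\<^bsub>M\<^esub> x \<oplus>\<^bsub>M\<^esub> b \<odot>\<^bsub>M\<^esub> x"
    and smult_r_distr:
      "\<lbrakk>a \<in> carrier R; x \<in> carrier M; y \<in> carrier M\<rbrakk> \<Longrightarrow>
        a \<odot>\<^bsub>M\<^esub> (x \<oplus>\<^bsub>M\<^esub> y) = a \<odot>\<^bsub>M\<^esub> x \<oplus>\<^bsub>M\<^esub> a \<odot>\<^bsub>M\<^esub> y"
    and smult_assoc1:
      "\<lbrakk>a \<in> carrier R; b \<in> carrier R; x \<in> carrier M\<rbrakk> \<Longrightarrow>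
        (a \<otimes>\<^bsub>R\<^esub> b) \<odot>\<^bsub>M\<^esub> x = a \<odot>\<^bsub>M\<^esub> (b \<odot>\<^bsub>M\<^esub> x)"
    and smult_one:
      "x \<in> carrier M \<Longrightarrow> \<one>\<^bsub>R\<^esub> \<odot>\<^bsub>M\<^esub> x = x"

text \<open>
  Morphisms are extensional functions, so that equality of morphisms is equality in HOL;
  composition is \<^const>\<open>compose\<close>.
\<close>

definition lmod_hom ::
  "('r, 'k) ring_scheme \<Rightarrow> ('r, 'm) module \<Rightarrow> ('r, 'n) module \<Rightarrow> ('m \<Rightarrow> 'n) set"
  where "lmod_hom R M N = {f \<in> carrier M \<rightarrow>\<^sub>E carrier N.
    (\<forall>x\<in>carrier M. \<forall>y\<in>carrier M. f (x \<oplus>\<^bsub>M\<^esub> y) = f x \<oplus>\<^bsub>N\<^esub> f y) \<and>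
    (\<forall>a\<in>carrier R. \<forall>x\<in>carrier M. f (a \<odot>\<^bsub>M\<^esub> x) = a \<odot>\<^bsub>N\<^esub> f x)}"

definition lmod_id :: "('r, 'm) module \<Rightarrow> 'm \<Rightarrow> 'm"
  where "lmod_id M = (\<lambda>x\<in>carrier M. x)"

definition lmod_iso ::
  "('r, 'k) ring_scheme \<Rightarrow> ('r, 'm) module \<Rightarrow> ('r, 'n) module \<Rightarrow> ('m \<Rightarrow> 'n) set"
  where "lmod_iso R M N = {f \<in> lmod_hom R M N. \<exists>g\<in>lmod_hom R N M.
    compose (carrier M) g f = lmod_id M \<and> compose (carrier N) f g = lmod_id N}"

definition hom_add :: "('r, 'm) module \<Rightarrow> ('r, 'n) module \<Rightarrow> ('m \<Rightarrow> 'n) \<Rightarrow> ('m \<Rightarrow> 'n) \<Rightarrow> 'm \<Rightarrow> 'n"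
  where "hom_add M N f g = (\<lambda>x\<in>carrier M. f x \<oplus>\<^bsub>N\<^esub> g x)"


section \<open>Tensor product of a right module and a left module\<close>

text \<open>
  In the following, \<open>X\<close> is an abelian group with a right action \<open>act :: 'x \<Rightarrow> 'r \<Rightarrow> 'x\<close> of
  \<open>R\<close>, and \<open>M\<close> is a left \<open>R\<close>-module. The scalar multiplication of the record \<open>X\<close> is a further
  left structure on \<open>X\<close> (over a possibly different ring), commuting with \<open>act\<close>; it
  induces the left structure of the tensor product.
\<close>

type_synonym ('x, 'm) tens = "('x \<times> 'm \<Rightarrow>\<^sub>0 int) set"

definition tensor_rel ::
  "('r, 'k) ring_scheme \<Rightarrow> ('x \<Rightarrow> 'r \<Rightarrow> 'x) \<Rightarrow> ('s, 'x) module \<Rightarrow> ('r, 'm) module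
    \<Rightarrow> ('x \<times> 'm \<Rightarrow>\<^sub>0 int) set"
  where "tensor_rel R act X M =
    {frag_of (x \<oplus>\<^bsub>X\<^esub> y, m) - frag_of (x, m) - frag_of (y, m) | x y m.
       x \<in> carrier X \<and> y \<in> carrier X \<and> m \<in> carrier M} \<union>
    {frag_of (x, m \<oplus>\<^bsub>M\<^esub> n) - frag_of (x, m) - frag_of (x, n) | x m n.
       x \<in> carrier X \<and> m \<in> carrier M \<and> n \<in> carrier M} \<union>
    {frag_of (act x r, m) - frag_of (x, r \<odot>\<^bsub>M\<^esub> m) | x r m.
       x \<in> carrier X \<and> r \<in> carrier R \<and> m \<in> carrier M}"

definition tensor_sub ::
  "('r, 'k) ring_scheme \<Rightarrow> ('x \<Rightarrow> 'r \<Rightarrow> 'x) \<Rightarrow> ('s, 'x) module \<Rightarrow> ('r, 'm) module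
    \<Rightarrow> ('x \<times> 'm \<Rightarrow>\<^sub>0 int) set"
  where "tensor_sub R act X M =
    generate (free_Abelian_group (carrier X \<times> carrier M)) (tensor_rel R act X M)"

definition tensor_pure ::
  "('r, 'k) ring_scheme \<Rightarrow> ('x \<Rightarrow> 'r \<Rightarrow> 'x) \<Rightarrow> ('s, 'x) module \<Rightarrow> ('r, 'm) module
    \<Rightarrow> 'x \<Rightarrow> 'm \<Rightarrow> ('x, 'm) tens"
  where "tensor_pure R act X M x m =
    tensor_sub R act X M #>\<^bsub>free_Abelian_group (carrier X \<times> carrier M)\<^esub> frag_of (x, m)"

definition tensor_group ::
  "('r, 'k) ring_scheme \<Rightarrow> ('x \<Rightarrow> 'r \<Rightarrow> 'x) \<Rightarrow> ('s, 'x) module \<Rightarrow> ('r, 'm) module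
    \<Rightarrow> ('x, 'm) tens ring"
  where "tensor_group R act X M =
    (let Q = free_Abelian_group (carrier X \<times> carrier M) Mod tensor_sub R act X M
     in \<lparr>carrier = carrier Q, monoid.mult = undefined, one = undefined,
         ring.zero = \<one>\<^bsub>Q\<^esub>, ring.add = (\<otimes>\<^bsub>Q\<^esub>)\<rparr>)"

text \<open>
  If \<open>b\<close> is biadditive and balanced, \<open>tensor_lift T b\<close> is the additive map to \<open>T\<close> with
  \<open>x \<otimes> m \<mapsto> b x m\<close>: it sends the class of \<open>\<Sum> k\<^sub>i (x\<^sub>i, m\<^sub>i)\<close> to \<open>\<Sum> k\<^sub>i b x\<^sub>i m\<^sub>i\<close>, and the choice of the
  representative does not matter.
\<close>

definition tensor_lift ::
  "('t, 'k) ring_scheme \<Rightarrow> ('x \<Rightarrow> 'm \<Rightarrow> 't) \<Rightarrow> ('x, 'm) tens \<Rightarrow> 't"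
  where "tensor_lift T b C =
    (let c = (SOME c. c \<in> C)
     in \<Oplus>\<^bsub>T\<^esub>p\<in>Poly_Mapping.keys c. [Poly_Mapping.lookup c p] \<cdot>\<^bsub>T\<^esub> b (fst p) (snd p))"

definition tensor ::
  "('r, 'k) ring_scheme \<Rightarrow> ('x \<Rightarrow> 'r \<Rightarrow> 'x) \<Rightarrow> ('s, 'x) module \<Rightarrow> ('r, 'm) module
    \<Rightarrow> ('s, ('x, 'm) tens) module"
  where "tensor R act X M =
    (let T = tensor_group R act X M
     in \<lparr>carrier = carrier T, monoid.mult = undefined, one = undefined,
         ring.zero = \<zero>\<^bsub>T\<^esub>, ring.add = (\<oplus>\<^bsub>T\<^esub>),
         smult = (\<lambda>s. tensor_lift T (\<lambda>x m. tensor_pure R act X M (s \<odot>\<^bsub>X\<^esub> x) m))\<rparr>)"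


section \<open>Column-finite matrices\<close>

type_synonym vec = "nat \<Rightarrow> int"
type_synonym mat = "nat \<Rightarrow> nat \<Rightarrow> int"
type_synonym cube = "nat \<Rightarrow> nat \<Rightarrow> nat \<Rightarrow> int"

text \<open>
  All matrix sums below are restricted to the support of the factor which is finite by
  column-finiteness.
\<close>

definition MM :: "mat ring"
  where "MM = \<lparr>carrier = {c. \<forall>n. finite {k. c k n \<noteq> 0}},
    monoid.mult = (\<lambda>a b i k. \<Sum>l | b l k \<noteq> 0. a i l * b l k),
    one = (\<lambda>i j. if i = j then 1 else 0),
    ring.zero = (\<lambda>i j. 0),
    ring.add = (\<lambda>a b i j. a i j + b i j)\<rparr>"

definition Zb :: "(mat, vec) module"
  where "Zb = \<lparr>carrier = {z. finite {k. z k \<noteq> 0}},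
    monoid.mult = undefined, one = undefined,
    ring.zero = (\<lambda>i. 0),
    ring.add = (\<lambda>y z i. y i + z i),
    smult = (\<lambda>u z i. \<Sum>l | z l \<noteq> 0. u i l * z l)\<rparr>"

definition MM2 :: "(mat, cube) module"
  where "MM2 = \<lparr>carrier = {c. \<forall>j k. finite {i. c i j k \<noteq> 0}},
    monoid.mult = undefined, one = undefined,
    ring.zero = (\<lambda>i j k. 0),
    ring.add = (\<lambda>c d i j k. c i j k + d i j k),
    smult = (\<lambda>u c i j k. \<Sum>l | c l j k \<noteq> 0. u i l * c l j k)\<rparr>"

definition ract1 :: "cube \<Rightarrow> mat \<Rightarrow> cube"
  where "ract1 c u = (\<lambda>i j k. \<Sum>l | u l j \<noteq> 0. c i l k * u l j)"

definition ract2 :: "cube \<Rightarrow> mat \<Rightarrow> cube"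
  where "ract2 c u = (\<lambda>i j k. \<Sum>l | u l k \<noteq> 0. c i j l * u l k)"


section \<open>The internal tensor product\<close>

type_synonym ('m, 'n) itens = "((cube, 'm) tens, 'n) tens"

definition ract_res :: "(mat, 'm) module \<Rightarrow> (cube, 'm) tens \<Rightarrow> mat \<Rightarrow> (cube, 'm) tens"
  where "ract_res M t u =
    tensor_lift (tensor MM ract1 MM2 M) (\<lambda>c m. tensor_pure MM ract1 MM2 M (ract2 c u) m) t"

definition itensor ::
  "(mat, 'm) module \<Rightarrow> (mat, 'n) module \<Rightarrow> (mat, ('m, 'n) itens) module"  (infixl \<open>\<boxtimes>\<close> 70)
  where "M \<boxtimes> N = tensor MM (ract_res M) (tensor MM ract1 MM2 M) N"

text \<open>The element \<open>(c \<otimes> m) \<otimes> n\<close>.\<close>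

definition ipure ::
  "(mat, 'm) module \<Rightarrow> (mat, 'n) module \<Rightarrow> cube \<Rightarrow> 'm \<Rightarrow> 'n \<Rightarrow> ('m, 'n) itens"
  where "ipure M N c m n =
    tensor_pure MM (ract_res M) (tensor MM ract1 MM2 M) N (tensor_pure MM ract1 MM2 M c m) n"

text \<open>The additive map to \<open>T\<close> with \<open>(c \<otimes> m) \<otimes> n \<mapsto> \<phi> c m n\<close>.\<close>

definition ilift ::
  "('t, 'k) ring_scheme \<Rightarrow> (cube \<Rightarrow> 'm \<Rightarrow> 'n \<Rightarrow> 't) \<Rightarrow> ('m, 'n) itens \<Rightarrow> 't"
  where "ilift T \<phi> = tensor_lift T (\<lambda>x n. tensor_lift T (\<lambda>c m. \<phi> c m n) x)"

definition itensor_map ::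
  "(mat, 'm) module \<Rightarrow> (mat, 'm1) module \<Rightarrow> (mat, 'n) module \<Rightarrow> (mat, 'n1) module
    \<Rightarrow> ('m \<Rightarrow> 'm1) \<Rightarrow> ('n \<Rightarrow> 'n1) \<Rightarrow> ('m, 'n) itens \<Rightarrow> ('m1, 'n1) itens"
  where "itensor_map M M' N N' f g =
    (\<lambda>t\<in>carrier (M \<boxtimes> N). ilift (M' \<boxtimes> N') (\<lambda>c m n. ipure M' N' c (f m) (g n)) t)"


section \<open>Structural isomorphisms\<close>

text \<open>Contraction of the second, respectively third, index with a finite column vector.\<close>

definition contract1 :: "cube \<Rightarrow> vec \<Rightarrow> mat"
  where "contract1 c z = (\<lambda>i k. \<Sum>j | z j \<noteq> 0. c i j k * z j)"

definition contract2 :: "cube \<Rightarrow> vec \<Rightarrow> mat"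
  where "contract2 c z = (\<lambda>i j. \<Sum>k | z k \<noteq> 0. c i j k * z k)"

definition lunit :: "(mat, 'n) module \<Rightarrow> (vec, 'n) itens \<Rightarrow> 'n"
  where "lunit N = (\<lambda>t\<in>carrier (Zb \<boxtimes> N). ilift N (\<lambda>c z n. contract1 c z \<odot>\<^bsub>N\<^esub> n) t)"

definition runit :: "(mat, 'm) module \<Rightarrow> ('m, vec) itens \<Rightarrow> 'm"
  where "runit M = (\<lambda>t\<in>carrier (M \<boxtimes> Zb). ilift M (\<lambda>c m z. contract2 c z \<odot>\<^bsub>M\<^esub> m) t)"

definition braid :: "(mat, 'm) module \<Rightarrow> (mat, 'n) module \<Rightarrow> ('m, 'n) itens \<Rightarrow> ('n, 'm) itens"
  where "braid M N =
    (\<lambda>t\<in>carrier (M \<boxtimes> N). ilift (N \<boxtimes> M) (\<lambda>c m n. ipure N M (\<lambda>i j k. c i k j) n m) t)"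

text \<open>
  The associator comes from the identifications of \<open>MM2 \<otimes> MM2\<close> over \<open>MM\<close>, formed with the first
  or with the second right structure of the left factor, with the families
  \<open>[e\<^sub>i\<^sub>a\<^sub>b\<^sub>k]\<close> that are finite in \<open>i\<close>:
  \<open>c \<otimes>\<^sub>1 d \<mapsto> \<Sum>\<^sub>j c\<^sub>i\<^sub>j\<^sub>k d\<^sub>j\<^sub>a\<^sub>b\<close> and \<open>f \<otimes>\<^sub>2 g \<mapsto> \<Sum>\<^sub>l f\<^sub>i\<^sub>a\<^sub>l g\<^sub>l\<^sub>b\<^sub>k\<close>. By means of the pairing bijection
  \<^const>\<open>prod_encode\<close>, the inverse of the latter is \<open>e \<mapsto> f \<otimes>\<^sub>2 pair_cube\<close> where
  \<open>f\<^sub>i\<^sub>a\<^sub>l = e\<^sub>i\<^sub>a\<^sub>b\<^sub>k\<close> for \<open>l = prod_encode (b, k)\<close>. Hence the associator is given by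
  \<open>(c \<otimes> ((d \<otimes> m) \<otimes> n)) \<otimes> p \<mapsto> (assoc_cube c d \<otimes> m) \<otimes> ((pair_cube \<otimes> n) \<otimes> p)\<close>.
\<close>

definition pair_cube :: cube
  where "pair_cube = (\<lambda>l b k. if l = prod_encode (b, k) then 1 else 0)"

definition assoc_cube :: "cube \<Rightarrow> cube \<Rightarrow> cube"
  where "assoc_cube c d =
    (\<lambda>i a l. let (b, k) = prod_decode l in \<Sum>j | d j a b \<noteq> 0. c i j k * d j a b)"

definition assoc ::
  "(mat, 'm) module \<Rightarrow> (mat, 'n) module \<Rightarrow> (mat, 'p) module
    \<Rightarrow> (('m, 'n) itens, 'p) itens \<Rightarrow> ('m, ('n, 'p) itens) itens"
  where "assoc M N P = (\<lambda>t\<in>carrier ((M \<boxtimes> N) \<boxtimes> P).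
    ilift (M \<boxtimes> (N \<boxtimes> P))
      (\<lambda>c s p. ilift (M \<boxtimes> (N \<boxtimes> P))
        (\<lambda>d m n. ipure M (N \<boxtimes> P) (assoc_cube c d) m (ipure N P pair_cube n p)) s) t)"


section \<open>Internal Hom\<close>

text \<open>
  \<open>ihom N P\<close> is the group of \<open>MM\<close>-linear maps \<open>MM2 \<otimes> N \<rightarrow> P\<close>, the tensor product being formed with the
  second right structure of \<open>MM2\<close>; the first right structure gives the left action
  \<open>(u h) (c \<otimes> n) = h (c \<cdot>\<^sub>1 u \<otimes> n)\<close>.
\<close>

definition ihom ::
  "(mat, 'n) module \<Rightarrow> (mat, 'p) module \<Rightarrow> (mat, (cube, 'n) tens \<Rightarrow> 'p) module"
  where "ihom N P =
    (let T = tensor MM ract2 MM2 N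
     in \<lparr>carrier = lmod_hom MM T P, monoid.mult = undefined, one = undefined,
         ring.zero = (\<lambda>t\<in>carrier T. \<zero>\<^bsub>P\<^esub>),
         ring.add = hom_add T P,
         smult = (\<lambda>u h. \<lambda>t\<in>carrier T.
           h (tensor_lift T (\<lambda>c n. tensor_pure MM ract2 MM2 N (ract1 c u) n) t))\<rparr>)"

definition ihom_map ::
  "(mat, 'n) module \<Rightarrow> (mat, 'p) module \<Rightarrow> ('p \<Rightarrow> 'p1)
    \<Rightarrow> ((cube, 'n) tens \<Rightarrow> 'p) \<Rightarrow> ((cube, 'n) tens \<Rightarrow> 'p1)"
  where "ihom_map N P g =
    (\<lambda>h\<in>carrier (ihom N P). compose (carrier (tensor MM ract2 MM2 N)) g h)"

definition lmod_curry ::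
  "(mat, 'm) module \<Rightarrow> (mat, 'n) module \<Rightarrow> (mat, 'p) module
    \<Rightarrow> (('m, 'n) itens \<Rightarrow> 'p) \<Rightarrow> 'm \<Rightarrow> (cube, 'n) tens \<Rightarrow> 'p"
  where "lmod_curry M N P f = (\<lambda>m\<in>carrier M. \<lambda>t\<in>carrier (tensor MM ract2 MM2 N).
    tensor_lift P (\<lambda>c n. f (ipure M N c m n)) t)"

end

theory Submission
  imports Defs
begin

text \<open>
  A linear map out of \<^term>\<open>M \<boxtimes> N\<close> is determined by its values on the elements
  \<open>(c \<otimes> m) \<otimes> n\<close>, so every coherence law is an identity between two such
  elements, up to moving matrices across the tensor signs. The key point is that \<^const>\<open>MM2\<close> is free
  of rank one over \<^const>\<open>MM\<close>, with generator \<^const>\<open>pair_cube\<close>: writing \<open>d = u \<cdot> pair_cube\<close> one gets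
  \<open>(c \<otimes> m) \<otimes> ((d \<otimes> n) \<otimes> p) = (c \<cdot>\<^sub>2 u \<otimes> m) \<otimes> ((pair_cube \<otimes> n) \<otimes> p)\<close>. This gives the associator,
  and reduces the pentagon, the triangle and the hexagon to identities between finite sums of products
  of coefficients.
\<close>

section \<open>Tensor products over a noncommutative ring\<close>

text \<open>\<open>MM2\<close> is free of rank one because pairing identifies N x N with N: merging
  the last two indices of d into one code gives the matrix \<open>flat_cube d\<close> with d =
  \<open>flat_cube d\<close> \<cdot> \<open>pair_cube\<close>. The price is bookkeeping: the two
  routes around a coherence diagram may code the same indices by differently nested or ordered
  pairs. Recoding is itself a matrix, \<open>flat_cube\<close> of a cube built from
  \<open>pair_cube\<close>, and it crosses the tensor sign like any other; this is how the pentagon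
  and the hexagon close. Rows of a column-finite matrix may be infinite, so all coefficient sums are
  one-sided, an arbitrary row against a finite column. Associativity therefore rests on finiteness
  of columns, while two contractions against independent columns commute outright. The left unit is
  inverted by hand; the right unit and the inverse associator are obtained from what is already
  known by composing with braidings. The lift of a balanced map, given by a choice of
  representative, has first to be shown independent of the choice.\<close>

lemma tensor_lift_cong:
  assumes "carrier S = carrier T" "\<zero>\<^bsub>S\<^esub> = \<zero>\<^bsub>T\<^esub>" "(\<oplus>\<^bsub>S\<^esub>) = (\<oplus>\<^bsub>T\<^esub>)"
  shows "tensor_lift S b C = tensor_lift T b C"
proof -
  have "[k] \<cdot>\<^bsub>S\<^esub> x = [k] \<cdot>\<^bsub>T\<^esub> x" for k :: int and x
    using assms by (simp add: add_pow_def int_pow_def nat_pow_def m_inv_def Let_def)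
  then show ?thesis
    using assms by (simp add: tensor_lift_def finsum_def finprod_def)
qed

section \<open>The tensor product as an abelian group and its universal property\<close>

definition balanced ::
  "('r, 'k) ring_scheme \<Rightarrow> ('x \<Rightarrow> 'r \<Rightarrow> 'x) \<Rightarrow> ('s, 'x) module \<Rightarrow> ('r, 'm) module
    \<Rightarrow> ('t, 'l) ring_scheme \<Rightarrow> ('x \<Rightarrow> 'm \<Rightarrow> 't) \<Rightarrow> bool"
  where "balanced R act X M T b \<longleftrightarrow>
    (\<forall>x\<in>carrier X. \<forall>m\<in>carrier M. b x m \<in> carrier T) \<and>
    (\<forall>x\<in>carrier X. \<forall>y\<in>carrier X. \<forall>m\<in>carrier M. b (x \<oplus>\<^bsub>X\<^esub> y) m = b x m \<oplus>\<^bsub>T\<^esub> b y m) \<and>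
    (\<forall>x\<in>carrier X. \<forall>m\<in>carrier M. \<forall>n\<in>carrier M. b x (m \<oplus>\<^bsub>M\<^esub> n) = b x m \<oplus>\<^bsub>T\<^esub> b x n) \<and>
    (\<forall>x\<in>carrier X. \<forall>r\<in>carrier R. \<forall>m\<in>carrier M. b (act x r) m = b x (r \<odot>\<^bsub>M\<^esub> m))"

text \<open>At this stage everything is additive: the quotient group and the maps out of it. The
  laws of scalars on the tensor product come with \<open>tensor_module\<close>, where a left action
  on X commuting with \<open>act\<close> is added.\<close>

locale tensor_setup = X: abelian_group X + M: abelian_group M
  for R :: "('r, 'k) ring_scheme" and act :: "'x \<Rightarrow> 'r \<Rightarrow> 'x"
    and X :: "('s, 'x) module" and M :: "('r, 'm) module" +
  assumes act_closed: "\<lbrakk>x \<in> carrier X; r \<in> carrier R\<rbrakk> \<Longrightarrow> act x r \<in> carrier X"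
    and scale_closed: "\<lbrakk>r \<in> carrier R; m \<in> carrier M\<rbrakk> \<Longrightarrow> r \<odot>\<^bsub>M\<^esub> m \<in> carrier M"
begin

abbreviation "Fr \<equiv> free_Abelian_group (carrier X \<times> carrier M)"
abbreviation "H \<equiv> tensor_sub R act X M"
abbreviation "TT \<equiv> tensor R act X M"
abbreviation "pure \<equiv> tensor_pure R act X M"

sublocale Fr: comm_group Fr
  by (rule abelian_free_Abelian_group)

lemma tensor_rel_subset: "tensor_rel R act X M \<subseteq> carrier Fr"
  unfolding tensor_rel_def
  by (auto simp: act_closed scale_closed dest!: subsetD [OF keys_diff])

lemma subgroup_tensor_sub: "subgroup H Fr"
  unfolding tensor_sub_def by (rule Fr.generate_is_subgroup [OF tensor_rel_subset])

sublocale H: normal H Fr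
  using Fr.subgroup_imp_normal [OF subgroup_tensor_sub] .

lemma carrier_tensor: "carrier TT = (\<lambda>c. H #>\<^bsub>Fr\<^esub> c) ` carrier Fr"
  by (simp add: tensor_def tensor_group_def Let_def carrier_FactGroup)

lemma coset_add:
  assumes "c \<in> carrier Fr" "d \<in> carrier Fr"
  shows "(H #>\<^bsub>Fr\<^esub> c) \<oplus>\<^bsub>TT\<^esub> (H #>\<^bsub>Fr\<^esub> d) = H #>\<^bsub>Fr\<^esub> (c + d)"
  using H.rcos_sum [OF assms] by (simp add: tensor_def tensor_group_def Let_def)

lemma coset_zero: "\<zero>\<^bsub>TT\<^esub> = H #>\<^bsub>Fr\<^esub> 0"
  using Fr.coset_mult_one [OF H.subset] by (simp add: tensor_def tensor_group_def Let_def)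

lemma abelian_group_tensor: "abelian_group TT"
proof -
  interpret Q: comm_group "Fr Mod H"
    using Fr.abelian_FactGroup subgroup_tensor_sub by blast
  have TT: "carrier TT = carrier (Fr Mod H)" "(\<oplus>\<^bsub>TT\<^esub>) = (\<otimes>\<^bsub>Fr Mod H\<^esub>)" "\<zero>\<^bsub>TT\<^esub> = \<one>\<^bsub>Fr Mod H\<^esub>"
    by (simp_all add: tensor_def tensor_group_def Let_def)
  show ?thesis
    by (rule abelian_groupI; unfold TT)
      (rule Q.m_closed Q.one_closed Q.m_assoc Q.m_comm Q.l_one Q.l_inv_ex; assumption?)+
qed

lemma pure_closed: "\<lbrakk>x \<in> carrier X; m \<in> carrier M\<rbrakk> \<Longrightarrow> pure x m \<in> carrier TT"
  by (auto simp: carrier_tensor tensor_pure_def)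

lemma coset_eqI:
  assumes "c - d \<in> H" "c \<in> carrier Fr" "d \<in> carrier Fr"
  shows "H #>\<^bsub>Fr\<^esub> c = H #>\<^bsub>Fr\<^esub> d"
proof -
  have "c \<in> H #>\<^bsub>Fr\<^esub> d"
    using assms by (force simp: r_coset_def)
  then show ?thesis
    using Fr.repr_independence [OF _ _ subgroup_tensor_sub, of c d] assms(3) by simp
qed

lemma rel_in_sub: "c \<in> tensor_rel R act X M \<Longrightarrow> c \<in> H"
  unfolding tensor_sub_def by (rule generate.incl)

lemma pure_add_left:
  assumes "x \<in> carrier X" "y \<in> carrier X" "m \<in> carrier M"
  shows "pure (x \<oplus>\<^bsub>X\<^esub> y) m = pure x m \<oplus>\<^bsub>TT\<^esub> pure y m"
proof -
  have "frag_of (x \<oplus>\<^bsub>X\<^esub> y, m) - (frag_of (x, m) + frag_of (y, m)) \<in> H"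
    by (rule rel_in_sub) (use assms in \<open>auto simp: tensor_rel_def algebra_simps\<close>)
  moreover have "frag_of (x, m) + frag_of (y, m) \<in> carrier Fr"
    using Fr.m_closed [of "frag_of (x, m)" "frag_of (y, m)"] assms by simp
  ultimately show ?thesis
    unfolding tensor_pure_def using assms by (simp only: coset_add frag_of_in_free_Abelian_group mem_Sigma_iff simp_thms)
      (intro coset_eqI; simp)
qed

lemma pure_add_right:
  assumes "x \<in> carrier X" "m \<in> carrier M" "n \<in> carrier M"
  shows "pure x (m \<oplus>\<^bsub>M\<^esub> n) = pure x m \<oplus>\<^bsub>TT\<^esub> pure x n"
proof -
  have "frag_of (x, m \<oplus>\<^bsub>M\<^esub> n) - (frag_of (x, m) + frag_of (x, n)) \<in> H"
    by (rule rel_in_sub) (use assms in \<open>auto simp: tensor_rel_def algebra_simps\<close>)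
  moreover have "frag_of (x, m) + frag_of (x, n) \<in> carrier Fr"
    using Fr.m_closed [of "frag_of (x, m)" "frag_of (x, n)"] assms by simp
  ultimately show ?thesis
    unfolding tensor_pure_def using assms by (simp only: coset_add frag_of_in_free_Abelian_group mem_Sigma_iff simp_thms)
      (intro coset_eqI; simp)
qed

lemma pure_act:
  assumes "x \<in> carrier X" "r \<in> carrier R" "m \<in> carrier M"
  shows "pure (act x r) m = pure x (r \<odot>\<^bsub>M\<^esub> m)"
proof -
  have "frag_of (act x r, m) - frag_of (x, r \<odot>\<^bsub>M\<^esub> m) \<in> H"
    by (rule rel_in_sub) (use assms in \<open>auto simp: tensor_rel_def\<close>)
  then show ?thesis
    unfolding tensor_pure_def using assms by (intro coset_eqI) (auto simp: act_closed scale_closed)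
qed

sublocale TT: abelian_group TT
  by (rule abelian_group_tensor)

lemma pure_zero_left: "m \<in> carrier M \<Longrightarrow> pure \<zero>\<^bsub>X\<^esub> m = \<zero>\<^bsub>TT\<^esub>"
  using pure_add_left [of "\<zero>\<^bsub>X\<^esub>" "\<zero>\<^bsub>X\<^esub>" m] pure_closed [of "\<zero>\<^bsub>X\<^esub>" m]
  by (metis TT.add.l_cancel_one' X.l_zero X.zero_closed)

text \<open>Negatives are absorbed by the left factor, - (x \<otimes> m) = (- x) \<otimes> m, so
  every element is a sum of pure tensors and no case for negation arises.\<close>

lemma tensor_induct [consumes 1, case_names pure add]:
  assumes t: "t \<in> carrier TT"
    and pure: "\<And>x m. \<lbrakk>x \<in> carrier X; m \<in> carrier M\<rbrakk> \<Longrightarrow> P (pure x m)"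
    and add: "\<And>s t. \<lbrakk>s \<in> carrier TT; t \<in> carrier TT; P s; P t\<rbrakk> \<Longrightarrow> P (s \<oplus>\<^bsub>TT\<^esub> t)"
  shows "P t"
proof -
  obtain c where c: "c \<in> carrier Fr" "t = H #>\<^bsub>Fr\<^esub> c"
    using t carrier_tensor by auto
  \<comment> \<open>Induction on the free group has a case for differences; carrying c and - c
    together turns x - y into the sum x + (- y).\<close>
  define Q where "Q c \<longleftrightarrow> P (H #>\<^bsub>Fr\<^esub> c) \<and> P (H #>\<^bsub>Fr\<^esub> (- c))" for c
  have keys: "c \<in> carrier Fr" if "Poly_Mapping.keys c \<subseteq> carrier X \<times> carrier M" for c
    using that by simp
  have P0: "P \<zero>\<^bsub>TT\<^esub>"
    using pure [of "\<zero>\<^bsub>X\<^esub>" "\<zero>\<^bsub>M\<^esub>"] pure_zero_left by simp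
  have addF: "P (H #>\<^bsub>Fr\<^esub> (c + d))" if "c \<in> carrier Fr" "d \<in> carrier Fr"
      "P (H #>\<^bsub>Fr\<^esub> c)" "P (H #>\<^bsub>Fr\<^esub> d)" for c d
    using add [of "H #>\<^bsub>Fr\<^esub> c" "H #>\<^bsub>Fr\<^esub> d"] that
    by (simp only: coset_add carrier_tensor) blast
  have "Q c"
    using c(1) [simplified]
  proof (induction rule: free_Abelian_group_induct [consumes 1, case_names zero diff frag])
    case zero
    then show ?case using P0 [unfolded coset_zero] by (simp only: Q_def minus_zero simp_thms)
  next
    case (diff x y)
    then show ?case
      unfolding Q_def using addF [of x "- y"] addF [of y "- x"] by simp
  next
    case (frag a)
    then obtain x m where a: "a = (x, m)" "x \<in> carrier X" "m \<in> carrier M" by auto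
    have "frag_of (\<ominus>\<^bsub>X\<^esub> x, m) + frag_of (x, m) \<in> carrier Fr"
      using a Fr.m_closed [of "frag_of (\<ominus>\<^bsub>X\<^esub> x, m)" "frag_of (x, m)"] by simp
    moreover have "pure (\<ominus>\<^bsub>X\<^esub> x) m \<oplus>\<^bsub>TT\<^esub> pure x m = \<zero>\<^bsub>TT\<^esub>"
      using a pure_add_left [of "\<ominus>\<^bsub>X\<^esub> x" x m] pure_zero_left by (simp add: X.l_neg)
    moreover have "pure x m \<oplus>\<^bsub>TT\<^esub> (H #>\<^bsub>Fr\<^esub> (- frag_of a)) = \<zero>\<^bsub>TT\<^esub>"
      unfolding tensor_pure_def a(1) using a by (subst coset_add) (auto simp: coset_zero)
    moreover have "H #>\<^bsub>Fr\<^esub> (- frag_of a) \<in> carrier TT"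
      using frag by (auto simp: carrier_tensor)
    \<comment> \<open>Both sides are the additive inverse of x \<otimes> m.\<close>
    ultimately have "H #>\<^bsub>Fr\<^esub> (- frag_of a) = pure (\<ominus>\<^bsub>X\<^esub> x) m"
      using a by (metis TT.a_comm TT.minus_equality X.a_inv_closed pure_closed)
    then show ?case
      unfolding Q_def using pure [of x m] pure [of "\<ominus>\<^bsub>X\<^esub> x" m] a by (simp add: tensor_pure_def)
  qed
  then show ?thesis by (simp add: Q_def c(2))
qed

text \<open>\<open>tensor_lift\<close> evaluates at a representative picked by \<open>SOME\<close>.
  The evaluation is a homomorphism h of the free group that kills every relator, hence the whole
  subgroup \<open>H\<close>; so it is constant on cosets and any representative may be used.\<close>

lemma lift_coset:
  assumes T: "abelian_group T" and b: "balanced R act X M T b"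
  obtains h where "h \<in> hom Fr (add_monoid T)"
    "\<And>x m. \<lbrakk>x \<in> carrier X; m \<in> carrier M\<rbrakk> \<Longrightarrow> h (frag_of (x, m)) = b x m"
    "\<And>c. c \<in> carrier Fr \<Longrightarrow> tensor_lift T b (H #>\<^bsub>Fr\<^esub> c) = h c"
proof -
  interpret T: abelian_group T by (rule T)
  have bc: "b x m \<in> carrier T" if "x \<in> carrier X" "m \<in> carrier M" for x m
    using b that by (simp add: balanced_def)
  obtain h where h: "h \<in> hom Fr (add_monoid T)"
    and hfrag: "\<And>p. p \<in> carrier X \<times> carrier M \<Longrightarrow> h (frag_of p) = b (fst p) (snd p)"
  proof -
    have "(\<lambda>p. b (fst p) (snd p)) ` (carrier X \<times> carrier M) \<subseteq> carrier T"
      using bc by auto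
    then show ?thesis
      by (rule T.add.free_Abelian_group_universal) (rule that, simp_all)
  qed
  interpret h: group_hom Fr "add_monoid T" h
    by (simp add: group_hom_def group_hom_axioms_def h T.a_group)
  have frag: "frag_of (x, m) \<in> carrier Fr" if "x \<in> carrier X" "m \<in> carrier M" for x m
    using that by simp
  have diffF: "c - d \<in> carrier Fr" if "c \<in> carrier Fr" "d \<in> carrier Fr" for c d
    using that by (auto dest!: subsetD [OF keys_diff])
  have hF: "h c \<in> carrier T" if "c \<in> carrier Fr" for c
    using h.hom_closed [OF that] by simp
  have hdiff: "h (c - d) = h c \<ominus>\<^bsub>T\<^esub> h d" if "c \<in> carrier Fr" "d \<in> carrier Fr" for c d
  proof -
    have "h (c - d) \<oplus>\<^bsub>T\<^esub> h d = h c"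
      using h.hom_mult [OF diffF that(2), OF that] by simp
    moreover have "(h (c - d) \<oplus>\<^bsub>T\<^esub> h d) \<ominus>\<^bsub>T\<^esub> h d = h (c - d)"
      using hF [OF that(2)] hF [OF diffF, OF that] by (simp add: a_minus_def T.a_assoc T.r_neg)
    ultimately show ?thesis by simp
  qed
  \<comment> \<open>After h is applied and b is expanded, a relator for additivity has this form;
    \<open>canc'\<close> is the form left by a relator for \<open>act\<close>.\<close>
  have canc: "(u \<oplus>\<^bsub>T\<^esub> v \<ominus>\<^bsub>T\<^esub> u) \<ominus>\<^bsub>T\<^esub> v = \<zero>\<^bsub>T\<^esub>"
    if "u \<in> carrier T" "v \<in> carrier T" for u v
    using T.r_neg [of "u \<oplus>\<^bsub>T\<^esub> v"] that by (simp add: a_minus_def T.a_assoc T.minus_add)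
  have canc': "u \<ominus>\<^bsub>T\<^esub> u = \<zero>\<^bsub>T\<^esub>" if "u \<in> carrier T" for u
    using T.r_neg [OF that] by (simp add: a_minus_def)
  have "tensor_rel R act X M \<subseteq> kernel Fr (add_monoid T) h"
  proof
    fix c assume c: "c \<in> tensor_rel R act X M"
    have b_add: "b (x \<oplus>\<^bsub>X\<^esub> y) m = b x m \<oplus>\<^bsub>T\<^esub> b y m"
      if "x \<in> carrier X" "y \<in> carrier X" "m \<in> carrier M" for x y m
      using b that by (simp add: balanced_def)
    have b_add': "b x (m \<oplus>\<^bsub>M\<^esub> n) = b x m \<oplus>\<^bsub>T\<^esub> b x n"
      if "x \<in> carrier X" "m \<in> carrier M" "n \<in> carrier M" for x m n
      using b that by (simp add: balanced_def)
    have b_act: "b (act x r) m = b x (r \<odot>\<^bsub>M\<^esub> m)"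
      if "x \<in> carrier X" "r \<in> carrier R" "m \<in> carrier M" for x r m
      using b that by (simp add: balanced_def)
    have hb: "h (frag_of (x, m)) = b x m" if "x \<in> carrier X" "m \<in> carrier M" for x m
      using hfrag [of "(x, m)"] that by simp
    from c consider
        x y m where "c = frag_of (x \<oplus>\<^bsub>X\<^esub> y, m) - frag_of (x, m) - frag_of (y, m)"
          "x \<in> carrier X" "y \<in> carrier X" "m \<in> carrier M"
      | x m n where "c = frag_of (x, m \<oplus>\<^bsub>M\<^esub> n) - frag_of (x, m) - frag_of (x, n)"
          "x \<in> carrier X" "m \<in> carrier M" "n \<in> carrier M"
      | x r m where "c = frag_of (act x r, m) - frag_of (x, r \<odot>\<^bsub>M\<^esub> m)"
          "x \<in> carrier X" "r \<in> carrier R" "m \<in> carrier M"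
      unfolding tensor_rel_def by blast
    then have "h c = \<zero>\<^bsub>T\<^esub>"
    proof cases
      case 1
      then show ?thesis
        by (simp only: hdiff diffF hb frag X.a_closed b_add canc bc)
    next
      case 2
      then show ?thesis
        by (simp only: hdiff diffF hb frag M.a_closed b_add' canc bc)
    next
      case 3
      then show ?thesis
        by (simp only: hdiff hb frag act_closed scale_closed b_act canc' bc)
    qed
    then show "c \<in> kernel Fr (add_monoid T) h"
      using c tensor_rel_subset unfolding kernel_def by (simp only: mem_Collect_eq monoid.select_convs) blast
  qed
  then have ker: "H \<subseteq> kernel Fr (add_monoid T) h"
    unfolding tensor_sub_def by (rule Fr.generate_subgroup_incl) (rule h.subgroup_kernel)
  \<comment> \<open>Links h with the explicit sum in \<open>tensor_lift\<close>: by
    \<open>frag_expansion\<close> an element of the free group is a sum of multiples of generators,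
    and h is evaluated term by term. Membership in the free group is carried along since additivity
    of h needs it.\<close>
  have hsum: "h (\<Sum>p\<in>I. frag_cmul (k p) (frag_of p)) =
      (\<Oplus>\<^bsub>T\<^esub>p\<in>I. [k p] \<cdot>\<^bsub>T\<^esub> b (fst p) (snd p)) \<and>
      (\<Sum>p\<in>I. frag_cmul (k p) (frag_of p)) \<in> carrier Fr"
    if "finite I" "I \<subseteq> carrier X \<times> carrier M" for I and k :: "'x \<times> 'm \<Rightarrow> int"
    using that
  proof (induction I)
    case empty
    then show ?case using h.hom_one by simp
  next
    case (insert p I)
    have p: "frag_of p \<in> carrier Fr" "p \<in> carrier X \<times> carrier M" "b (fst p) (snd p) \<in> carrier T"
      using insert.prems bc by auto
    have pk: "frag_cmul (k p) (frag_of p) = frag_of p [^]\<^bsub>Fr\<^esub> k p"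
      using p by (simp add: int_pow_free_Abelian_group)
    then have cl: "frag_cmul (k p) (frag_of p) \<in> carrier Fr"
      using p Fr.int_pow_closed by metis
    have hp: "h (frag_cmul (k p) (frag_of p)) = [k p] \<cdot>\<^bsub>T\<^esub> b (fst p) (snd p)"
      unfolding pk using h.hom_int_pow [OF p(1)] hfrag [OF p(2)] by (simp add: add_pow_def)
    have I: "(\<lambda>p. [k p] \<cdot>\<^bsub>T\<^esub> b (fst p) (snd p)) \<in> I \<rightarrow> carrier T"
      using insert.prems bc by (intro funcsetI T.add.int_pow_closed) auto
    have "(\<Oplus>\<^bsub>T\<^esub>p\<in>insert p I. [k p] \<cdot>\<^bsub>T\<^esub> b (fst p) (snd p)) =
        [k p] \<cdot>\<^bsub>T\<^esub> b (fst p) (snd p) \<oplus>\<^bsub>T\<^esub> (\<Oplus>\<^bsub>T\<^esub>p\<in>I. [k p] \<cdot>\<^bsub>T\<^esub> b (fst p) (snd p))"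
      by (rule T.finsum_insert [OF insert.hyps I T.add.int_pow_closed [OF p(3)]])
    moreover have IH: "h (\<Sum>p\<in>I. frag_cmul (k p) (frag_of p)) =
        (\<Oplus>\<^bsub>T\<^esub>p\<in>I. [k p] \<cdot>\<^bsub>T\<^esub> b (fst p) (snd p))"
      "(\<Sum>p\<in>I. frag_cmul (k p) (frag_of p)) \<in> carrier Fr"
      using insert.IH insert.prems by blast+
    ultimately show ?case
      using h.hom_mult [OF cl IH(2)] Fr.m_closed [OF cl IH(2)]
      by (simp only: sum.insert [OF insert.hyps] hp IH(1) mult_free_Abelian_group monoid.select_convs)
  qed
  have hval: "h c = (\<Oplus>\<^bsub>T\<^esub>p\<in>Poly_Mapping.keys c. [Poly_Mapping.lookup c p] \<cdot>\<^bsub>T\<^esub> b (fst p) (snd p))"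
    if "c \<in> carrier Fr" for c
    using hsum [of "Poly_Mapping.keys c" "Poly_Mapping.lookup c"] that frag_expansion [of c]
    by (simp add: frag_extend_def)
  show thesis
  proof
    show "h \<in> hom Fr (add_monoid T)" by (rule h)
    show "h (frag_of (x, m)) = b x m" if "x \<in> carrier X" "m \<in> carrier M" for x m
      using hfrag that by simp
    fix c assume c: "c \<in> carrier Fr"
    \<comment> \<open>The representative on which \<open>tensor_lift\<close> is evaluated; it
      differs from c by an element u of \<open>H\<close>, where h vanishes.\<close>
    define c' where "c' = (SOME c'. c' \<in> H #>\<^bsub>Fr\<^esub> c)"
    have "c' \<in> H #>\<^bsub>Fr\<^esub> c"
      unfolding c'_def using Fr.rcos_self [OF c subgroup_tensor_sub] by (rule someI)
    then obtain u where u: "u \<in> H" "c' = u + c"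
      by (auto simp: r_coset_def)
    have uc: "u \<in> carrier Fr" "h u = \<zero>\<^bsub>T\<^esub>"
      using u(1) ker by (auto simp: kernel_def)
    have "c' \<in> carrier Fr" "h c' = h c"
      using Fr.m_closed [OF uc(1) c] h.hom_mult [OF uc(1) c] uc(2) h.hom_closed [OF c]
      by (simp_all add: u(2))
    then show "tensor_lift T b (H #>\<^bsub>Fr\<^esub> c) = h c"
      unfolding tensor_lift_def Let_def by (simp add: hval [symmetric] c'_def [symmetric])
  qed
qed

context
  fixes T :: "('t, 'l) ring_scheme" and b
  assumes T: "abelian_group T" and b: "balanced R act X M T b"
begin

lemma lift_pure:
  assumes "x \<in> carrier X" "m \<in> carrier M"
  shows "tensor_lift T b (pure x m) = b x m"
  by (rule lift_coset [OF T b]) (use assms in \<open>simp add: tensor_pure_def\<close>)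

lemma lift_closed:
  assumes "t \<in> carrier TT"
  shows "tensor_lift T b t \<in> carrier T"
  by (rule lift_coset [OF T b]) (use assms in \<open>auto simp: carrier_tensor hom_def\<close>)

lemma lift_add:
  assumes "s \<in> carrier TT" "t \<in> carrier TT"
  shows "tensor_lift T b (s \<oplus>\<^bsub>TT\<^esub> t) = tensor_lift T b s \<oplus>\<^bsub>T\<^esub> tensor_lift T b t"
proof -
  obtain h where h: "h \<in> hom Fr (add_monoid T)"
    "\<And>c. c \<in> carrier Fr \<Longrightarrow> tensor_lift T b (H #>\<^bsub>Fr\<^esub> c) = h c"
    using lift_coset [OF T b] by metis
  obtain c d where c: "c \<in> carrier Fr" "s = H #>\<^bsub>Fr\<^esub> c" and d: "d \<in> carrier Fr" "t = H #>\<^bsub>Fr\<^esub> d"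
    using assms by (auto simp: carrier_tensor)
  have "c + d \<in> carrier Fr"
    using Fr.m_closed [OF c(1) d(1)] by simp
  then show ?thesis
    using hom_mult [OF h(1) c(1) d(1)] c d by (simp only: coset_add h(2)) simp
qed

end

lemma tensor_additive_eq:
  assumes "t \<in> carrier TT"
    and "\<And>s t. \<lbrakk>s \<in> carrier TT; t \<in> carrier TT\<rbrakk> \<Longrightarrow> f (s \<oplus>\<^bsub>TT\<^esub> t) = f s \<oplus>\<^bsub>T\<^esub> f t"
    and "\<And>s t. \<lbrakk>s \<in> carrier TT; t \<in> carrier TT\<rbrakk> \<Longrightarrow> g (s \<oplus>\<^bsub>TT\<^esub> t) = g s \<oplus>\<^bsub>T\<^esub> g t"
    and "\<And>x m. \<lbrakk>x \<in> carrier X; m \<in> carrier M\<rbrakk> \<Longrightarrow> f (pure x m) = g (pure x m)"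
  shows "f t = g t"
  using assms(1) by (induction rule: tensor_induct) (simp_all add: assms)

text \<open>\<open>tensor\<close> defines its scalars by a lift into \<open>tensor_group\<close>, a
  record without scalars but with the same addition. This identification makes the lifting facts for
  \<open>TT\<close> available for scalar multiplication.\<close>

lemma tensor_lift_group:
  "tensor_lift (tensor_group R act X M) b = tensor_lift TT b"
  by (intro ext tensor_lift_cong) (simp_all add: tensor_def tensor_group_def Let_def)

lemma smult_tensor:
  "s \<odot>\<^bsub>TT\<^esub> t = tensor_lift TT (\<lambda>x m. pure (s \<odot>\<^bsub>X\<^esub> x) m) t"
  by (subst (1) tensor_def) (simp add: Let_def tensor_lift_group)

end

text \<open>The map \<phi> \<otimes> id. Left scalars, the right action \<open>ract_res\<close> that
  remains on \<open>MM2 \<otimes> M\<close>, and the right multiplication behind \<open>ihom\<close>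
  are all of this kind, each for a \<phi> commuting with \<open>act\<close>.\<close>

definition tensor_endo ::
  "('r, 'k) ring_scheme \<Rightarrow> ('x \<Rightarrow> 'r \<Rightarrow> 'x) \<Rightarrow> ('s, 'x) module \<Rightarrow> ('r, 'm) module
    \<Rightarrow> ('x \<Rightarrow> 'x) \<Rightarrow> ('x, 'm) tens \<Rightarrow> ('x, 'm) tens"
  where "tensor_endo R act X M \<phi> =
    tensor_lift (tensor R act X M) (\<lambda>x m. tensor_pure R act X M (\<phi> x) m)"

context tensor_setup
begin

context
  fixes \<phi>
  assumes \<phi>_closed: "\<And>x. x \<in> carrier X \<Longrightarrow> \<phi> x \<in> carrier X"
    and \<phi>_add: "\<And>x y. \<lbrakk>x \<in> carrier X; y \<in> carrier X\<rbrakk> \<Longrightarrow> \<phi> (x \<oplus>\<^bsub>X\<^esub> y) = \<phi> x \<oplus>\<^bsub>X\<^esub> \<phi> y"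
    and \<phi>_act: "\<And>x r. \<lbrakk>x \<in> carrier X; r \<in> carrier R\<rbrakk> \<Longrightarrow> \<phi> (act x r) = act (\<phi> x) r"
begin

lemma balanced_endo: "balanced R act X M TT (\<lambda>x m. pure (\<phi> x) m)"
  by (simp add: balanced_def \<phi>_closed \<phi>_add \<phi>_act pure_closed pure_add_left pure_add_right pure_act)

lemmas endo_pure = lift_pure [OF abelian_group_tensor balanced_endo, folded tensor_endo_def]
  and endo_closed = lift_closed [OF abelian_group_tensor balanced_endo, folded tensor_endo_def]
  and endo_add = lift_add [OF abelian_group_tensor balanced_endo, folded tensor_endo_def]

end

end

section \<open>The left module structure on the tensor product\<close>

locale tensor_module = X: left_module S X + M: left_module R M
  for S :: "('s, 'l) ring_scheme" and R :: "('r, 'k) ring_scheme" and act :: "'x \<Rightarrow> 'r \<Rightarrow> 'x"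
    and X :: "('s, 'x) module" and M :: "('r, 'm) module" +
  assumes right_closed: "\<lbrakk>x \<in> carrier X; r \<in> carrier R\<rbrakk> \<Longrightarrow> act x r \<in> carrier X"
    and smult_act: "\<lbrakk>s \<in> carrier S; x \<in> carrier X; r \<in> carrier R\<rbrakk> \<Longrightarrow>
      s \<odot>\<^bsub>X\<^esub> act x r = act (s \<odot>\<^bsub>X\<^esub> x) r"
begin

sublocale tensor_setup R act X M
  by unfold_locales (simp_all add: right_closed M.smult_closed)

lemma smult_eq_endo: "s \<odot>\<^bsub>TT\<^esub> t = tensor_endo R act X M (\<lambda>x. s \<odot>\<^bsub>X\<^esub> x) t"
  by (simp add: smult_tensor tensor_endo_def)

context
  fixes s
  assumes s: "s \<in> carrier S"
begin

lemma smult_pure: "\<lbrakk>x \<in> carrier X; m \<in> carrier M\<rbrakk> \<Longrightarrow> s \<odot>\<^bsub>TT\<^esub> pure x m = pure (s \<odot>\<^bsub>X\<^esub> x) m"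
  unfolding smult_eq_endo
  by (rule endo_pure) (simp_all add: s X.smult_closed X.smult_r_distr smult_act)

lemma smult_tensor_closed: "t \<in> carrier TT \<Longrightarrow> s \<odot>\<^bsub>TT\<^esub> t \<in> carrier TT"
  unfolding smult_eq_endo
  by (rule endo_closed) (simp_all add: s X.smult_closed X.smult_r_distr smult_act)

lemma smult_tensor_add:
  "\<lbrakk>t \<in> carrier TT; t' \<in> carrier TT\<rbrakk> \<Longrightarrow> s \<odot>\<^bsub>TT\<^esub> (t \<oplus>\<^bsub>TT\<^esub> t') = s \<odot>\<^bsub>TT\<^esub> t \<oplus>\<^bsub>TT\<^esub> s \<odot>\<^bsub>TT\<^esub> t'"
  unfolding smult_eq_endo
  by (rule endo_add) (simp_all add: s X.smult_closed X.smult_r_distr smult_act)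

end

lemma left_module_tensor: "left_module S TT"
proof (unfold_locales, goal_cases)
  \<comment> \<open>Goals 2, 4 and 5 are distributivity over a sum of scalars, associativity and the
    unit law. Each side is additive in t, so pure tensors decide.\<close>
  case (2 a b t)
  then have a: "a \<in> carrier S" "b \<in> carrier S" by simp_all
  from 2(3) show ?case
    by (induction rule: tensor_induct)
      (simp_all add: a smult_pure smult_tensor_add smult_tensor_closed X.smult_closed X.smult_l_distr
        pure_add_left TT.a_ac)
next
  case (4 a b t)
  then have a: "a \<in> carrier S" "b \<in> carrier S" by simp_all
  from 4(3) show ?case
    by (induction rule: tensor_induct)
      (simp_all add: a smult_pure smult_tensor_add smult_tensor_closed X.smult_closed X.smult_assoc1)
next
  case (5 t)
  then show ?case
    by (induction rule: tensor_induct)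
      (simp_all add: smult_pure smult_tensor_add smult_tensor_closed X.smult_one)
qed (simp_all add: smult_tensor_closed smult_tensor_add)

lemma endo_smult:
  assumes \<phi>: "\<And>x. x \<in> carrier X \<Longrightarrow> \<phi> x \<in> carrier X"
    "\<And>x y. \<lbrakk>x \<in> carrier X; y \<in> carrier X\<rbrakk> \<Longrightarrow> \<phi> (x \<oplus>\<^bsub>X\<^esub> y) = \<phi> x \<oplus>\<^bsub>X\<^esub> \<phi> y"
    "\<And>x r. \<lbrakk>x \<in> carrier X; r \<in> carrier R\<rbrakk> \<Longrightarrow> \<phi> (act x r) = act (\<phi> x) r"
    and \<phi>_smult: "\<And>s x. \<lbrakk>s \<in> carrier S; x \<in> carrier X\<rbrakk> \<Longrightarrow> \<phi> (s \<odot>\<^bsub>X\<^esub> x) = s \<odot>\<^bsub>X\<^esub> \<phi> x"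
    and "s \<in> carrier S" "t \<in> carrier TT"
  shows "tensor_endo R act X M \<phi> (s \<odot>\<^bsub>TT\<^esub> t) = s \<odot>\<^bsub>TT\<^esub> tensor_endo R act X M \<phi> t"
  using assms(6)
proof (induction rule: tensor_induct)
  case (pure x m)
  then show ?case
    using assms(5) by (simp add: endo_pure [OF \<phi>] smult_pure X.smult_closed \<phi>(1) \<phi>_smult)
next
  case (add t t')
  then show ?case
    using assms(5)
    by (simp add: endo_add [OF \<phi>] endo_closed [OF \<phi>] smult_tensor_add smult_tensor_closed)
qed

end

section \<open>Finite sums of products of coefficients\<close>

text \<open>A row times a column, with the sum over the support of the column, since rows of
  column-finite matrices may be infinite. If z has infinite support the value is 0 by the convention
  for infinite sums, so additivity in f holds for every z.\<close>

definition dot :: "vec \<Rightarrow> vec \<Rightarrow> int"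
  where "dot f z = (\<Sum>l | z l \<noteq> 0. f l * z l)"

abbreviation fin :: "vec \<Rightarrow> bool"
  where "fin z \<equiv> finite {k. z k \<noteq> 0}"

lemma dot_superset:
  assumes "finite A" "{l. z l \<noteq> 0} \<subseteq> A"
  shows "dot f z = (\<Sum>l\<in>A. f l * z l)"
  unfolding dot_def using assms by (intro sum.mono_neutral_left) auto

lemma fin_add: "fin y \<Longrightarrow> fin z \<Longrightarrow> fin (\<lambda>l. y l + z l)"
  by (rule finite_subset [of _ "{l. y l \<noteq> 0} \<union> {l. z l \<noteq> 0}"]) auto

lemma fin_unit: "fin (\<lambda>l. if l = j then 1 else 0)" "fin (\<lambda>l. if j = l then 1 else 0)"
  by simp_all

lemma dot_zeroI: "(\<And>l. z l \<noteq> 0 \<Longrightarrow> f l = 0) \<Longrightarrow> dot f z = 0"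
  by (simp add: dot_def)

lemma dot_support: "{m. dot (b m) z \<noteq> 0} \<subseteq> (\<Union>l\<in>{l. z l \<noteq> 0}. {m. b m l \<noteq> 0})"
proof
  fix m assume "m \<in> {m. dot (b m) z \<noteq> 0}"
  then have "\<not> (\<forall>l. z l \<noteq> 0 \<longrightarrow> b m l = 0)"
    using dot_zeroI [of z "b m"] by blast
  then show "m \<in> (\<Union>l\<in>{l. z l \<noteq> 0}. {m. b m l \<noteq> 0})"
    by blast
qed

lemma fin_dot: "fin z \<Longrightarrow> (\<And>l. fin (\<lambda>m. b m l)) \<Longrightarrow> fin (\<lambda>m. dot (b m) z)"
  by (rule finite_subset [OF dot_support]) simp

lemma dot_add_left: "dot (\<lambda>l. f l + g l) z = dot f z + dot g z"
  by (simp add: dot_def distrib_right sum.distrib)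

lemma dot_add_right:
  assumes "fin y" "fin z"
  shows "dot f (\<lambda>l. y l + z l) = dot f y + dot f z"
proof -
  let ?A = "{l. y l \<noteq> 0} \<union> {l. z l \<noteq> 0}"
  have "dot f (\<lambda>l. y l + z l) = (\<Sum>l\<in>?A. f l * (y l + z l))"
    using assms by (intro dot_superset) auto
  also have "\<dots> = (\<Sum>l\<in>?A. f l * y l) + (\<Sum>l\<in>?A. f l * z l)"
    by (simp add: distrib_left sum.distrib)
  also have "\<dots> = dot f y + dot f z"
    using assms by (subst (1 2) dot_superset [where A = ?A]) auto
  finally show ?thesis .
qed

lemma dot_zero: "dot (\<lambda>l. 0) z = 0" "dot f (\<lambda>l. 0) = 0"
  by (simp_all add: dot_def)

lemma dot_unit_right:
  "dot f (\<lambda>l. if l = j then 1 else 0) = f j" "dot f (\<lambda>l. if j = l then 1 else 0) = f j"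
  by (simp_all add: dot_def)

lemma dot_unit_left:
  assumes "fin z"
  shows "dot (\<lambda>l. if l = i then 1 else 0) z = z i" "dot (\<lambda>l. if i = l then 1 else 0) z = z i"
proof -
  show "dot (\<lambda>l. if l = i then 1 else 0) z = z i"
    using assms by (subst dot_superset [where A = "insert i {l. z l \<noteq> 0}"]) (auto simp: if_distrib if_distribR cong: if_cong)
  then show "dot (\<lambda>l. if i = l then 1 else 0) z = z i"
    by (simp add: eq_commute)
qed

text \<open>Associativity of row, matrix and column, (f b) z = f (b z). The support of column l of b
  varies with l; the union of these supports over l in the support of z is finite and serves as one
  index set for both orders of summation.\<close>

lemma dot_dot:
  assumes z: "fin z" and b: "\<And>l. fin (\<lambda>m. b m l)"
  shows "dot (\<lambda>l. dot f (\<lambda>m. b m l)) z = dot f (\<lambda>m. dot (b m) z)"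
proof -
  let ?A = "{l. z l \<noteq> 0}" and ?B = "\<Union>l\<in>{l. z l \<noteq> 0}. {m. b m l \<noteq> 0}"
  have B: "finite ?B" using assms by simp
  have "dot (\<lambda>l. dot f (\<lambda>m. b m l)) z = (\<Sum>l\<in>?A. (\<Sum>m\<in>?B. f m * b m l) * z l)"
    unfolding dot_def [of _ z] using B
    by (intro sum.cong refl arg_cong2 [where f = "(*)"] dot_superset) auto
  also have "\<dots> = (\<Sum>m\<in>?B. f m * dot (b m) z)"
    unfolding dot_def sum_distrib_left sum_distrib_right
    by (subst sum.swap) (simp add: mult.assoc)
  also have "\<dots> = dot f (\<lambda>m. dot (b m) z)"
    by (rule dot_superset [symmetric, OF B dot_support])
  finally show ?thesis .
qed

text \<open>Here the two index sets are the supports of y and z, independent of each other, so the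
  sums can simply be exchanged. It is the reason why the two right actions commute.\<close>

lemma dot_swap: "dot (\<lambda>l. dot (\<lambda>m. c m l) y) z = dot (\<lambda>m. dot (\<lambda>l. c m l) z) y"
  unfolding dot_def sum_distrib_right
  by (subst sum.swap) (simp add: mult_ac)

section \<open>Matrices, finite vectors and cubes\<close>

lemma MM_simps:
  "carrier MM = {c. \<forall>n. fin (\<lambda>k. c k n)}"
  "a \<otimes>\<^bsub>MM\<^esub> b = (\<lambda>i k. dot (a i) (\<lambda>l. b l k))"
  "\<one>\<^bsub>MM\<^esub> = (\<lambda>i j. if i = j then 1 else 0)"
  "\<zero>\<^bsub>MM\<^esub> = (\<lambda>i j. 0)"
  "a \<oplus>\<^bsub>MM\<^esub> b = (\<lambda>i j. a i j + b i j)"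
  by (simp_all add: MM_def dot_def)

lemma Zb_simps:
  "carrier Zb = {z. fin z}"
  "\<zero>\<^bsub>Zb\<^esub> = (\<lambda>i. 0)"
  "y \<oplus>\<^bsub>Zb\<^esub> z = (\<lambda>i. y i + z i)"
  "u \<odot>\<^bsub>Zb\<^esub> z = (\<lambda>i. dot (u i) z)"
  by (simp_all add: Zb_def dot_def)

lemma MM2_simps:
  "carrier MM2 = {c. \<forall>j k. fin (\<lambda>i. c i j k)}"
  "\<zero>\<^bsub>MM2\<^esub> = (\<lambda>i j k. 0)"
  "c \<oplus>\<^bsub>MM2\<^esub> d = (\<lambda>i j k. c i j k + d i j k)"
  "u \<odot>\<^bsub>MM2\<^esub> c = (\<lambda>i j k. dot (u i) (\<lambda>l. c l j k))"
  by (simp_all add: MM2_def dot_def)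

lemma ract_dot:
  "ract1 c u = (\<lambda>i j k. dot (\<lambda>l. c i l k) (\<lambda>l. u l j))"
  "ract2 c u = (\<lambda>i j k. dot (c i j) (\<lambda>l. u l k))"
  by (simp_all add: ract1_def ract2_def dot_def)

lemma contract_dot:
  "contract1 c z = (\<lambda>i k. dot (\<lambda>j. c i j k) z)"
  "contract2 c z = (\<lambda>i j. dot (c i j) z)"
  by (simp_all add: contract1_def contract2_def dot_def)

lemma assoc_cube_dot:
  "assoc_cube c d = (\<lambda>i a l. dot (\<lambda>j. c i j (snd (prod_decode l))) (\<lambda>j. d j a (fst (prod_decode l))))"
  by (simp add: assoc_cube_def dot_def split_beta)

lemma ring_MM: "ring MM"
proof (intro ringI abelian_groupI monoidI, goal_cases)
  case (6 x)
  then show ?case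
    by (intro bexI [of _ "\<lambda>i j. - x i j"]) (simp_all add: MM_simps)
qed (auto simp: MM_simps ac_simps fin_add fin_dot fin_unit dot_add_left dot_add_right dot_unit_left
    dot_unit_right dot_dot)

lemma left_module_Zb: "left_module MM Zb"
proof -
  interpret ring MM by (rule ring_MM)
  interpret abelian_group Zb
  proof (intro abelian_groupI, goal_cases)
    case (6 x)
    then show ?case
      by (intro bexI [of _ "\<lambda>i. - x i"]) (simp_all add: Zb_simps)
  qed (auto simp: Zb_simps ac_simps fin_add)
  show ?thesis
    by unfold_locales
      (auto simp: Zb_simps MM_simps fin_dot dot_add_left dot_add_right dot_unit_left dot_dot)
qed

lemma left_module_MM2: "left_module MM MM2"
proof -
  interpret ring MM by (rule ring_MM)
  interpret abelian_group MM2
  proof (intro abelian_groupI, goal_cases)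
    case (6 x)
    then show ?case
      by (intro bexI [of _ "\<lambda>i j k. - x i j k"]) (simp_all add: MM2_simps)
  qed (auto simp: MM2_simps ac_simps fin_add)
  show ?thesis
    by unfold_locales
      (auto simp: MM2_simps MM_simps fin_dot dot_add_left dot_add_right dot_unit_left dot_dot)
qed

lemma ract_closed:
  assumes "c \<in> carrier MM2" "u \<in> carrier MM"
  shows "ract1 c u \<in> carrier MM2" "ract2 c u \<in> carrier MM2"
  using assms by (simp_all add: ract_dot MM2_simps MM_simps fin_dot)

lemma ract_add:
  "ract1 (c \<oplus>\<^bsub>MM2\<^esub> d) u = ract1 c u \<oplus>\<^bsub>MM2\<^esub> ract1 d u"
  "ract2 (c \<oplus>\<^bsub>MM2\<^esub> d) u = ract2 c u \<oplus>\<^bsub>MM2\<^esub> ract2 d u"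
  by (simp_all add: ract_dot MM2_simps dot_add_left)

lemma ract1_ring:
  assumes "u \<in> carrier MM" "v \<in> carrier MM"
  shows "ract1 c (u \<oplus>\<^bsub>MM\<^esub> v) = ract1 c u \<oplus>\<^bsub>MM2\<^esub> ract1 c v"
    "ract1 c (u \<otimes>\<^bsub>MM\<^esub> v) = ract1 (ract1 c u) v"
  using assms by (simp_all add: ract_dot MM2_simps MM_simps dot_add_right dot_dot)

lemma ract1_one: "ract1 c \<one>\<^bsub>MM\<^esub> = c"
  by (simp add: ract_dot MM_simps dot_unit_right)

lemma smult_ract:
  assumes "u \<in> carrier MM" "c \<in> carrier MM2" "v \<in> carrier MM"
  shows "u \<odot>\<^bsub>MM2\<^esub> ract1 c v = ract1 (u \<odot>\<^bsub>MM2\<^esub> c) v"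
    "u \<odot>\<^bsub>MM2\<^esub> ract2 c v = ract2 (u \<odot>\<^bsub>MM2\<^esub> c) v"
  using assms by (simp_all add: ract_dot MM2_simps MM_simps dot_dot)

lemma ract_commute: "ract2 (ract1 c u) v = ract1 (ract2 c v) u"
  unfolding ract_dot by (intro ext dot_swap)

lemma contract_closed:
  assumes "c \<in> carrier MM2" "z \<in> carrier Zb"
  shows "contract1 c z \<in> carrier MM" "contract2 c z \<in> carrier MM"
  using assms by (simp_all add: contract_dot MM2_simps MM_simps Zb_simps fin_dot)

text \<open>It commutes with left scalars and exchanges the two right actions, which makes the
  braiding balanced and linear and transfers facts on the second index to the third.\<close>

definition swap_cube :: "cube \<Rightarrow> cube"
  where "swap_cube c = (\<lambda>i j k. c i k j)"

lemma swap_cube_closed: "c \<in> carrier MM2 \<Longrightarrow> swap_cube c \<in> carrier MM2"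
  by (simp add: swap_cube_def MM2_simps)

lemma swap_cube_ops:
  "swap_cube (swap_cube c) = c"
  "swap_cube (c \<oplus>\<^bsub>MM2\<^esub> d) = swap_cube c \<oplus>\<^bsub>MM2\<^esub> swap_cube d"
  "swap_cube (u \<odot>\<^bsub>MM2\<^esub> c) = u \<odot>\<^bsub>MM2\<^esub> swap_cube c"
  "swap_cube (ract1 c v) = ract2 (swap_cube c) v"
  "swap_cube (ract2 c v) = ract1 (swap_cube c) v"
  by (simp_all add: swap_cube_def MM2_simps ract_dot)

text \<open>The coordinate of d in the free module \<open>MM2\<close>: the matrix u with u \<cdot>
  \<open>pair_cube\<close> = d.\<close>

definition flat_cube :: "cube \<Rightarrow> mat"
  where "flat_cube d = (\<lambda>i l. d i (fst (prod_decode l)) (snd (prod_decode l)))"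

lemma flat_cube_closed: "d \<in> carrier MM2 \<Longrightarrow> flat_cube d \<in> carrier MM"
  by (simp add: flat_cube_def MM2_simps MM_simps)

lemma pair_cube_closed: "pair_cube \<in> carrier MM2"
  by (simp add: pair_cube_def MM2_simps fin_unit)

text \<open>For fixed b and k, \<open>pair_cube\<close> is the unit vector at the code of (b, k), so
  the product selects that column of \<open>flat_cube d\<close>.\<close>

lemma flat_cube_pair_cube: "flat_cube d \<odot>\<^bsub>MM2\<^esub> pair_cube = d"
  by (simp add: flat_cube_def pair_cube_def MM2_simps dot_unit_right)

lemma assoc_cube_closed:
  assumes "c \<in> carrier MM2" "d \<in> carrier MM2"
  shows "assoc_cube c d \<in> carrier MM2"
  using assms by (simp add: assoc_cube_dot MM2_simps fin_dot)

lemma assoc_cube_add_left: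
  "assoc_cube (c \<oplus>\<^bsub>MM2\<^esub> c') d = assoc_cube c d \<oplus>\<^bsub>MM2\<^esub> assoc_cube c' d"
  by (simp add: assoc_cube_dot MM2_simps dot_add_left)

lemma assoc_cube_add_right:
  assumes "d \<in> carrier MM2" "d' \<in> carrier MM2"
  shows "assoc_cube c (d \<oplus>\<^bsub>MM2\<^esub> d') = assoc_cube c d \<oplus>\<^bsub>MM2\<^esub> assoc_cube c d'"
  using assms by (simp add: assoc_cube_dot MM2_simps dot_add_right)

lemma assoc_cube_smult:
  assumes "c \<in> carrier MM2" "d \<in> carrier MM2"
  shows "assoc_cube (u \<odot>\<^bsub>MM2\<^esub> c) d = u \<odot>\<^bsub>MM2\<^esub> assoc_cube c d"
  using assms by (simp add: assoc_cube_dot MM2_simps dot_dot)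

text \<open>The summation index j plays the role of a tensor product over \<open>MM\<close>: a
  matrix inserted there may act on c or on d. The index a is a column index of d alone, so an action
  there comes out of the sum.\<close>

lemma assoc_cube_ract1:
  assumes "d \<in> carrier MM2" "u \<in> carrier MM"
  shows "assoc_cube (ract1 c u) d = assoc_cube c (u \<odot>\<^bsub>MM2\<^esub> d)"
    "assoc_cube c (ract1 d u) = ract1 (assoc_cube c d) u"
  using assms by (simp_all add: assoc_cube_dot ract_dot MM2_simps MM_simps dot_dot)

lemma dot_pair_cube: "dot f (\<lambda>l. pair_cube l b k) = f (prod_encode (b, k))"
  by (simp add: pair_cube_def dot_unit_right)

text \<open>A matrix acting on one component of a pair becomes a matrix on codes, whose columns are
  contractions of \<open>pair_cube\<close> with columns z. The two parts evaluate a row f against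
  such a column, for the first and for the second component.\<close>

lemma ract2_flat_cube:
  assumes "fin z"
  shows "dot f (\<lambda>l. dot (\<lambda>b. pair_cube l b k) z) = dot (\<lambda>b. f (prod_encode (b, k))) z"
    and "dot f (\<lambda>l. dot (pair_cube l b) z) = dot (\<lambda>k. f (prod_encode (b, k))) z"
  using dot_dot [OF assms, of "\<lambda>l b. pair_cube l b k" f] dot_dot [OF assms, of "\<lambda>l k. pair_cube l b k" f]
    pair_cube_closed
  by (simp_all add: dot_pair_cube MM2_simps)

text \<open>In \<open>assoc_cube c d\<close> the last index codes a pair (b, k) with b from d and k
  from c. A right action of u on b or k thus becomes an action on codes by \<open>flat_cube\<close>
  of \<open>pair_cube\<close> acted on by u. Across the tensor sign that matrix yields
  \<open>pair_cube\<close> with u acting on its second or third index, whence u reaches n or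
  p.\<close>

lemma assoc_cube_ract2:
  assumes "d \<in> carrier MM2" "u \<in> carrier MM"
  shows "assoc_cube c (ract2 d u) = ract2 (assoc_cube c d) (flat_cube (ract1 pair_cube u))"
    and "assoc_cube (ract2 c u) d = ract2 (assoc_cube c d) (flat_cube (ract2 pair_cube u))"
proof -
  have u: "fin (\<lambda>l. u l j)" and d: "fin (\<lambda>l. d l a b)" for j a b
    using assms by (simp_all add: MM_simps MM2_simps)
  show "assoc_cube c (ract2 d u) = ract2 (assoc_cube c d) (flat_cube (ract1 pair_cube u))"
    by (simp add: assoc_cube_dot ract_dot flat_cube_def ract2_flat_cube u d dot_dot)
  show "assoc_cube (ract2 c u) d = ract2 (assoc_cube c d) (flat_cube (ract2 pair_cube u))"
    by (simp add: assoc_cube_dot ract_dot flat_cube_def ract2_flat_cube u) (intro ext dot_swap)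
qed

text \<open>The cube left by the associator after \<open>assoc_inv\<close>: the passages through
  codes cancel except for the coding of d, which \<open>ipure_right_flat\<close> undoes. The next
  lemma is the counterpart for the other composite, undone by
  \<open>ipure_left_flat\<close>.\<close>

lemma assoc_cube_swap_swap:
  "assoc_cube (swap_cube (assoc_cube (swap_cube c) (swap_cube d))) (swap_cube pair_cube) =
    ract2 c (flat_cube d)"
  by (simp add: assoc_cube_dot ract_dot flat_cube_def swap_cube_def dot_pair_cube)

lemma swap_assoc_cube_swap:
  "swap_cube (assoc_cube (swap_cube (assoc_cube c d)) (swap_cube pair_cube)) =
    ract1 c (flat_cube (swap_cube d))"
  by (simp add: assoc_cube_dot ract_dot flat_cube_def swap_cube_def dot_pair_cube)

text \<open>The last index on the left codes (x, (y, z)), where x, y, z are last indices of f, d and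
  c; in \<open>assoc_cube c (assoc_cube d f)\<close> it codes ((x, y), z). The matrix on the right
  recodes one into the other. It comes from the route on which an associator is applied to
  \<open>pair_cube\<close> nested in \<open>pair_cube\<close>.\<close>

lemma assoc_cube_pentagon:
  assumes "d \<in> carrier MM2" "f \<in> carrier MM2"
  shows "assoc_cube (assoc_cube c d) f =
    ract2 (assoc_cube c (assoc_cube d f)) (flat_cube (assoc_cube pair_cube pair_cube))"
proof -
  have d: "fin (\<lambda>l. d l a b)" and f: "fin (\<lambda>l. f l a b)" for a b
    using assms by (simp_all add: MM2_simps)
  \<comment> \<open>Column (a, (b, k)) of the flat matrix is the unit vector at the code of ((a, b),
    k).\<close>
  have "assoc_cube pair_cube pair_cube = (\<lambda>i a l. pair_cube i (prod_encode (a, fst (prod_decode l))) (snd (prod_decode l)))"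
    by (simp add: assoc_cube_dot dot_pair_cube)
  then show ?thesis
    by (simp add: ract_dot flat_cube_def dot_pair_cube) (simp add: assoc_cube_dot d f dot_dot)
qed

text \<open>Both sides add up c(i,j,k) d(j,a,b) z(b) over j and b, in different orders; contracting
  \<open>pair_cube\<close> with z amounts to summing over the first component b of the coded pair
  (b, k).\<close>

lemma assoc_cube_triangle:
  assumes "d \<in> carrier MM2" "z \<in> carrier Zb"
  shows "ract2 (assoc_cube c d) (contract1 pair_cube z) = ract1 c (contract2 d z)"
proof -
  have d: "fin (\<lambda>l. d l a b)" and z: "fin z" for a b
    using assms by (simp_all add: MM2_simps Zb_simps)
  show ?thesis
    by (simp add: assoc_cube_dot contract_dot ract_dot ract2_flat_cube d z dot_dot)
qed

text \<open>The last index codes (b, k) on the left, but (k, b) in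
  \<open>assoc_cube c (swap_cube d)\<close>. The matrix exchanging the components is the trace of
  the last braiding, which acts on \<open>pair_cube\<close>.\<close>

lemma assoc_cube_hexagon:
  "assoc_cube (swap_cube (assoc_cube c d)) pair_cube =
    ract2 (assoc_cube c (swap_cube d)) (flat_cube (swap_cube pair_cube))"
  by (simp add: assoc_cube_dot ract_dot flat_cube_def swap_cube_def dot_pair_cube)

section \<open>Contractions and the unit cube\<close>

lemma contract_add:
  assumes "c \<in> carrier MM2" "d \<in> carrier MM2" "y \<in> carrier Zb" "z \<in> carrier Zb"
  shows "contract1 (c \<oplus>\<^bsub>MM2\<^esub> d) z = contract1 c z \<oplus>\<^bsub>MM\<^esub> contract1 d z"
    and "contract1 c (y \<oplus>\<^bsub>Zb\<^esub> z) = contract1 c y \<oplus>\<^bsub>MM\<^esub> contract1 c z"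
  using assms
  by (simp_all add: contract_dot MM2_simps MM_simps Zb_simps dot_add_left dot_add_right)

lemma contract_mult:
  assumes "c \<in> carrier MM2" "u \<in> carrier MM" "z \<in> carrier Zb"
  shows "contract1 (u \<odot>\<^bsub>MM2\<^esub> c) z = u \<otimes>\<^bsub>MM\<^esub> contract1 c z"
    and "contract1 (ract1 c u) z = contract1 c (u \<odot>\<^bsub>Zb\<^esub> z)"
    and "contract1 (ract2 c u) z = contract1 c z \<otimes>\<^bsub>MM\<^esub> u"
proof -
  have "fin z" "fin (\<lambda>l. u l j)" "fin (\<lambda>l. c l j k)" for j k
    using assms by (simp_all add: MM2_simps MM_simps Zb_simps)
  then show "contract1 (u \<odot>\<^bsub>MM2\<^esub> c) z = u \<otimes>\<^bsub>MM\<^esub> contract1 c z"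
    "contract1 (ract1 c u) z = contract1 c (u \<odot>\<^bsub>Zb\<^esub> z)"
    by (simp_all add: contract_dot ract_dot MM2_simps MM_simps Zb_simps dot_dot)
  show "contract1 (ract2 c u) z = contract1 c z \<otimes>\<^bsub>MM\<^esub> u"
    unfolding contract_dot ract_dot MM_simps by (intro ext dot_swap)
qed

lemma contract2_swap: "contract2 c z = contract1 (swap_cube c) z"
  by (simp add: contract_dot swap_cube_def)

text \<open>The inverse of \<^const>\<open>lunit\<close> is \<open>m \<mapsto> (unit_cube \<otimes> unit_vec) \<otimes> m\<close>.\<close>

definition unit_vec :: vec
  where "unit_vec = (\<lambda>i. if i = 0 then 1 else 0)"

definition unit_cube :: cube
  where "unit_cube = (\<lambda>i j k. if j = 0 \<and> i = k then 1 else 0)"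

text \<open>\<open>Zb\<close> is generated by \<open>unit_vec\<close>; this is a matrix carrying it
  to z.\<close>

definition column_mat :: "vec \<Rightarrow> mat"
  where "column_mat z = (\<lambda>i j. if j = 0 then z i else 0)"

lemma unit_closed: "unit_vec \<in> carrier Zb" "unit_cube \<in> carrier MM2"
  by (simp_all add: unit_vec_def unit_cube_def Zb_simps MM2_simps)

lemma column_mat:
  assumes "z \<in> carrier Zb"
  shows "column_mat z \<in> carrier MM" "column_mat z \<odot>\<^bsub>Zb\<^esub> unit_vec = z"
  using assms by (simp_all add: column_mat_def unit_vec_def Zb_simps MM_simps dot_unit_right)

text \<open>Both sides vanish for j \<noteq> 0, and the slice j = 0 of \<open>unit_cube\<close> is
  the identity matrix. The point is the exchange of right actions: what acted through z ends up in
  the second structure, where it can be passed on to the module.\<close>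

lemma ract1_column_mat:
  assumes "c \<in> carrier MM2" "z \<in> carrier Zb"
  shows "ract1 c (column_mat z) = ract2 unit_cube (contract1 c z)"
proof (intro ext)
  fix i j k
  have "fin (\<lambda>i. dot (\<lambda>j. c i j k) z)"
    using assms by (simp add: Zb_simps MM2_simps fin_dot)
  then show "ract1 c (column_mat z) i j k = ract2 unit_cube (contract1 c z) i j k"
    using dot_unit_left(2)
    by (cases "j = 0") (simp_all add: ract_dot column_mat_def unit_cube_def contract_dot dot_zero)
qed

lemma contract1_unit: "contract1 unit_cube unit_vec = \<one>\<^bsub>MM\<^esub>"
  by (simp add: contract_dot unit_vec_def unit_cube_def dot_unit_right MM_simps)

text \<open>On the identity slice j = 0 both sides are u, and elsewhere they vanish. This gives
  linearity of the inverse of \<open>lunit\<close>.\<close>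

lemma ract2_unit_cube:
  assumes "u \<in> carrier MM"
  shows "ract2 unit_cube u = u \<odot>\<^bsub>MM2\<^esub> unit_cube"
proof (intro ext)
  fix i j k
  have "fin (\<lambda>i. u i k)"
    using assms by (simp add: MM_simps)
  then show "ract2 unit_cube u i j k = (u \<odot>\<^bsub>MM2\<^esub> unit_cube) i j k"
    using dot_unit_left(2)
    by (cases "j = 0") (simp_all add: ract_dot MM2_simps unit_cube_def dot_zero dot_unit_right)
qed

section \<open>The internal tensor product\<close>

lemma lmod_homI:
  assumes "f \<in> extensional (carrier M)" "\<And>x. x \<in> carrier M \<Longrightarrow> f x \<in> carrier N"
    "\<And>x y. \<lbrakk>x \<in> carrier M; y \<in> carrier M\<rbrakk> \<Longrightarrow> f (x \<oplus>\<^bsub>M\<^esub> y) = f x \<oplus>\<^bsub>N\<^esub> f y"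
    "\<And>a x. \<lbrakk>a \<in> carrier R; x \<in> carrier M\<rbrakk> \<Longrightarrow> f (a \<odot>\<^bsub>M\<^esub> x) = a \<odot>\<^bsub>N\<^esub> f x"
  shows "f \<in> lmod_hom R M N"
  using assms by (auto simp: lmod_hom_def PiE_def)

lemma
  assumes "f \<in> lmod_hom R M N"
  shows lmod_hom_extensional: "f \<in> extensional (carrier M)"
    and lmod_hom_closed: "x \<in> carrier M \<Longrightarrow> f x \<in> carrier N"
    and lmod_hom_add: "\<lbrakk>x \<in> carrier M; y \<in> carrier M\<rbrakk> \<Longrightarrow> f (x \<oplus>\<^bsub>M\<^esub> y) = f x \<oplus>\<^bsub>N\<^esub> f y"
    and lmod_hom_smult: "\<lbrakk>a \<in> carrier R; x \<in> carrier M\<rbrakk> \<Longrightarrow> f (a \<odot>\<^bsub>M\<^esub> x) = a \<odot>\<^bsub>N\<^esub> f x"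
  using assms by (auto simp: lmod_hom_def PiE_def)

lemmas lmod_homD = lmod_hom_closed lmod_hom_add lmod_hom_smult

lemma lmod_hom_eqI:
  assumes "f \<in> lmod_hom R M N" "g \<in> lmod_hom R M N" "\<And>x. x \<in> carrier M \<Longrightarrow> f x = g x"
  shows "f = g"
  using extensionalityI [OF lmod_hom_extensional [OF assms(1)] lmod_hom_extensional [OF assms(2)]]
    assms(3) by blast

context left_module
begin

lemma lmod_hom_compose:
  assumes f: "f \<in> lmod_hom R M N" and g: "g \<in> lmod_hom R N P"
  shows "compose (carrier M) g f \<in> lmod_hom R M P"
  by (rule lmod_homI)
    (simp_all add: compose_def smult_closed lmod_homD [OF f] lmod_homD [OF g])

lemma lmod_id_hom: "lmod_id M \<in> lmod_hom R M M"
  by (rule lmod_homI) (simp_all add: lmod_id_def smult_closed)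

lemma smult_zero: "a \<in> carrier R \<Longrightarrow> a \<odot>\<^bsub>M\<^esub> \<zero>\<^bsub>M\<^esub> = \<zero>\<^bsub>M\<^esub>"
  using smult_r_distr [of a "\<zero>\<^bsub>M\<^esub>" "\<zero>\<^bsub>M\<^esub>"] smult_closed [of a "\<zero>\<^bsub>M\<^esub>"]
  by (metis M.add.l_cancel_one' M.l_zero M.zero_closed)

end

lemma hom_add_lmod_hom:
  assumes "left_module R M" "left_module R N" "f \<in> lmod_hom R M N" "g \<in> lmod_hom R M N"
  shows "hom_add M N f g \<in> lmod_hom R M N"
proof -
  interpret M: left_module R M by fact
  interpret N: left_module R N by fact
  note [simp] = lmod_homD [OF assms(3)] lmod_homD [OF assms(4)]
  show ?thesis
    by (rule lmod_homI) (simp_all add: hom_add_def M.smult_closed N.smult_r_distr N.a_ac)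
qed

lemma lmod_isoI:
  assumes "f \<in> lmod_hom R M N" "g \<in> lmod_hom R N M"
    "compose (carrier M) g f = lmod_id M" "compose (carrier N) f g = lmod_id N"
  shows "f \<in> lmod_iso R M N"
  using assms unfolding lmod_iso_def by blast

section \<open>Universal property of the internal tensor product\<close>

definition balanced3 ::
  "(mat, 'm) module \<Rightarrow> (mat, 'n) module \<Rightarrow> (mat, 't) module \<Rightarrow> (cube \<Rightarrow> 'm \<Rightarrow> 'n \<Rightarrow> 't) \<Rightarrow> bool"
  where "balanced3 M N T \<phi> \<longleftrightarrow>
    (\<forall>c\<in>carrier MM2. \<forall>m\<in>carrier M. \<forall>n\<in>carrier N. \<phi> c m n \<in> carrier T \<and>
      (\<forall>c'\<in>carrier MM2. \<phi> (c \<oplus>\<^bsub>MM2\<^esub> c') m n = \<phi> c m n \<oplus>\<^bsub>T\<^esub> \<phi> c' m n) \<and>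
      (\<forall>m'\<in>carrier M. \<phi> c (m \<oplus>\<^bsub>M\<^esub> m') n = \<phi> c m n \<oplus>\<^bsub>T\<^esub> \<phi> c m' n) \<and>
      (\<forall>n'\<in>carrier N. \<phi> c m (n \<oplus>\<^bsub>N\<^esub> n') = \<phi> c m n \<oplus>\<^bsub>T\<^esub> \<phi> c m n') \<and>
      (\<forall>u\<in>carrier MM. \<phi> (ract1 c u) m n = \<phi> c (u \<odot>\<^bsub>M\<^esub> m) n \<and> \<phi> (ract2 c u) m n = \<phi> c m (u \<odot>\<^bsub>N\<^esub> n)))"

interpretation MM: ring MM by (rule ring_MM)
interpretation MM2: left_module MM MM2 by (rule left_module_MM2)

lemma ract_res_endo: "ract_res M t u = tensor_endo MM ract1 MM2 M (\<lambda>c. ract2 c u) t"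
  by (simp add: ract_res_def tensor_endo_def)

lemma tensor_module_ract1: "left_module MM M \<Longrightarrow> tensor_module MM MM ract1 MM2 M"
  by (intro tensor_module.intro tensor_module_axioms.intro left_module_MM2)
    (simp_all add: ract_closed smult_ract)

lemma tensor_module_ract2: "left_module MM M \<Longrightarrow> tensor_module MM MM ract2 MM2 M"
  by (intro tensor_module.intro tensor_module_axioms.intro left_module_MM2)
    (simp_all add: ract_closed smult_ract)

context
  fixes M :: "(mat, 'm) module"
  assumes M: "left_module MM M"
begin

interpretation M: left_module MM M by (rule M)
interpretation T1: tensor_module MM MM ract1 MM2 M by (rule tensor_module_ract1 [OF M])

text \<open>\<open>ract2\<close> commutes with the first right action and with left scalars, so it
  descends to \<open>MM2 \<otimes> M\<close> and supplies the right action over which N is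
  tensored.\<close>

lemma ract_res:
  assumes "u \<in> carrier MM"
  shows "\<lbrakk>c \<in> carrier MM2; m \<in> carrier M\<rbrakk> \<Longrightarrow> ract_res M (T1.pure c m) u = T1.pure (ract2 c u) m"
    and "t \<in> carrier T1.TT \<Longrightarrow> ract_res M t u \<in> carrier T1.TT"
    and "\<lbrakk>s \<in> carrier T1.TT; t \<in> carrier T1.TT\<rbrakk> \<Longrightarrow>
      ract_res M (s \<oplus>\<^bsub>T1.TT\<^esub> t) u = ract_res M s u \<oplus>\<^bsub>T1.TT\<^esub> ract_res M t u"
    and "\<lbrakk>v \<in> carrier MM; t \<in> carrier T1.TT\<rbrakk> \<Longrightarrow>
      ract_res M (v \<odot>\<^bsub>T1.TT\<^esub> t) u = v \<odot>\<^bsub>T1.TT\<^esub> ract_res M t u"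
  unfolding ract_res_endo
     apply (rule T1.endo_pure; simp add: assms ract_closed ract_add ract_commute)
    apply (rule T1.endo_closed; simp add: assms ract_closed ract_add ract_commute)
   apply (rule T1.endo_add; simp add: assms ract_closed ract_add ract_commute)
  apply (rule T1.endo_smult; simp add: assms ract_closed ract_add ract_commute smult_ract)
  done

context
  fixes N :: "(mat, 'n) module"
  assumes N: "left_module MM N"
begin

interpretation N: left_module MM N by (rule N)

lemma tensor_module_itensor: "tensor_module MM MM (ract_res M) T1.TT N"
  by (intro tensor_module.intro tensor_module_axioms.intro T1.left_module_tensor N)
    (simp_all add: ract_res)

interpretation T: tensor_module MM MM "ract_res M" T1.TT N
  rewrites "tensor MM (ract_res M) T1.TT N = M \<boxtimes> N"
  by (rule tensor_module_itensor) (simp add: itensor_def)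

lemma left_module_itensor: "left_module MM (M \<boxtimes> N)"
  by (rule T.left_module_tensor)

lemma ipure_closed:
  "\<lbrakk>c \<in> carrier MM2; m \<in> carrier M; n \<in> carrier N\<rbrakk> \<Longrightarrow> ipure M N c m n \<in> carrier (M \<boxtimes> N)"
  unfolding ipure_def by (intro T.pure_closed T1.pure_closed)

lemma ipure_add1:
  "\<lbrakk>c \<in> carrier MM2; c' \<in> carrier MM2; m \<in> carrier M; n \<in> carrier N\<rbrakk> \<Longrightarrow>
    ipure M N (c \<oplus>\<^bsub>MM2\<^esub> c') m n = ipure M N c m n \<oplus>\<^bsub>M \<boxtimes> N\<^esub> ipure M N c' m n"
  unfolding ipure_def by (simp add: T.pure_add_left T1.pure_add_left T1.pure_closed)

lemma ipure_add2:
  "\<lbrakk>c \<in> carrier MM2; m \<in> carrier M; m' \<in> carrier M; n \<in> carrier N\<rbrakk> \<Longrightarrow>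
    ipure M N c (m \<oplus>\<^bsub>M\<^esub> m') n = ipure M N c m n \<oplus>\<^bsub>M \<boxtimes> N\<^esub> ipure M N c m' n"
  unfolding ipure_def by (simp add: T.pure_add_left T1.pure_add_right T1.pure_closed)

lemma ipure_add3:
  "\<lbrakk>c \<in> carrier MM2; m \<in> carrier M; n \<in> carrier N; n' \<in> carrier N\<rbrakk> \<Longrightarrow>
    ipure M N c m (n \<oplus>\<^bsub>N\<^esub> n') = ipure M N c m n \<oplus>\<^bsub>M \<boxtimes> N\<^esub> ipure M N c m n'"
  unfolding ipure_def by (simp add: T.pure_add_right T1.pure_closed)

lemma ipure_ract1:
  "\<lbrakk>c \<in> carrier MM2; m \<in> carrier M; n \<in> carrier N; u \<in> carrier MM\<rbrakk> \<Longrightarrow>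
    ipure M N (ract1 c u) m n = ipure M N c (u \<odot>\<^bsub>M\<^esub> m) n"
  unfolding ipure_def by (simp add: T1.pure_act)

lemma ipure_ract2:
  "\<lbrakk>c \<in> carrier MM2; m \<in> carrier M; n \<in> carrier N; u \<in> carrier MM\<rbrakk> \<Longrightarrow>
    ipure M N (ract2 c u) m n = ipure M N c m (u \<odot>\<^bsub>N\<^esub> n)"
  unfolding ipure_def by (simp add: T.pure_act [symmetric] T1.pure_closed ract_res)

lemma ipure_smult:
  "\<lbrakk>c \<in> carrier MM2; m \<in> carrier M; n \<in> carrier N; u \<in> carrier MM\<rbrakk> \<Longrightarrow>
    u \<odot>\<^bsub>M \<boxtimes> N\<^esub> ipure M N c m n = ipure M N (u \<odot>\<^bsub>MM2\<^esub> c) m n"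
  unfolding ipure_def by (simp add: T.smult_pure T1.smult_pure T1.pure_closed)

lemma itensor_induct [consumes 1, case_names pure add]:
  assumes t: "t \<in> carrier (M \<boxtimes> N)"
    and pure: "\<And>c m n. \<lbrakk>c \<in> carrier MM2; m \<in> carrier M; n \<in> carrier N\<rbrakk> \<Longrightarrow> P (ipure M N c m n)"
    and add: "\<And>s t. \<lbrakk>s \<in> carrier (M \<boxtimes> N); t \<in> carrier (M \<boxtimes> N); P s; P t\<rbrakk> \<Longrightarrow> P (s \<oplus>\<^bsub>M \<boxtimes> N\<^esub> t)"
  shows "P t"
  using t
proof (induction rule: T.tensor_induct)
  case (pure x n)
  from pure(1) show ?case
  proof (induction rule: T1.tensor_induct)
    case (pure c m)
    then show ?case
      using \<open>n \<in> carrier N\<close> assms(2) by (simp add: ipure_def)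
  next
    case (add s t)
    then show ?case
      using \<open>n \<in> carrier N\<close> assms(3) by (simp add: T.pure_add_left T.pure_closed)
  qed
qed (rule add)

context
  fixes T :: "(mat, 't) module" and \<phi>
  assumes T: "left_module MM T" and \<phi>: "balanced3 M N T \<phi>"
begin

interpretation T': left_module MM T by (rule T)

lemma
  shows balanced3_closed: "\<lbrakk>c \<in> carrier MM2; m \<in> carrier M; n \<in> carrier N\<rbrakk> \<Longrightarrow> \<phi> c m n \<in> carrier T"
    and balanced3_add1: "\<lbrakk>c \<in> carrier MM2; c' \<in> carrier MM2; m \<in> carrier M; n \<in> carrier N\<rbrakk> \<Longrightarrow>
      \<phi> (c \<oplus>\<^bsub>MM2\<^esub> c') m n = \<phi> c m n \<oplus>\<^bsub>T\<^esub> \<phi> c' m n"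
    and balanced3_add2: "\<lbrakk>c \<in> carrier MM2; m \<in> carrier M; m' \<in> carrier M; n \<in> carrier N\<rbrakk> \<Longrightarrow>
      \<phi> c (m \<oplus>\<^bsub>M\<^esub> m') n = \<phi> c m n \<oplus>\<^bsub>T\<^esub> \<phi> c m' n"
    and balanced3_add3: "\<lbrakk>c \<in> carrier MM2; m \<in> carrier M; n \<in> carrier N; n' \<in> carrier N\<rbrakk> \<Longrightarrow>
      \<phi> c m (n \<oplus>\<^bsub>N\<^esub> n') = \<phi> c m n \<oplus>\<^bsub>T\<^esub> \<phi> c m n'"
    and balanced3_ract1: "\<lbrakk>u \<in> carrier MM; c \<in> carrier MM2; m \<in> carrier M; n \<in> carrier N\<rbrakk> \<Longrightarrow>
      \<phi> (ract1 c u) m n = \<phi> c (u \<odot>\<^bsub>M\<^esub> m) n"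
    and balanced3_ract2: "\<lbrakk>u \<in> carrier MM; c \<in> carrier MM2; m \<in> carrier M; n \<in> carrier N\<rbrakk> \<Longrightarrow>
      \<phi> (ract2 c u) m n = \<phi> c m (u \<odot>\<^bsub>N\<^esub> n)"
  using \<phi> unfolding balanced3_def by blast+

lemma balanced_inner: "n \<in> carrier N \<Longrightarrow> balanced MM ract1 MM2 M T (\<lambda>c m. \<phi> c m n)"
  unfolding balanced_def by (simp add: balanced3_closed balanced3_add1 balanced3_add2 balanced3_ract1)

lemmas inner_pure = T1.lift_pure [OF T'.M.abelian_group_axioms balanced_inner]
  and inner_closed = T1.lift_closed [OF T'.M.abelian_group_axioms balanced_inner]
  and inner_add = T1.lift_add [OF T'.M.abelian_group_axioms balanced_inner]

text \<open>The inner lift runs over c and m with n as a parameter. Additivity in n and the exchange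
  of \<open>ract_res\<close> with u acting on n are equalities of additive functions of x, hence
  follow from the laws of \<phi> on pure tensors.\<close>

lemma balanced_outer:
  "balanced MM (ract_res M) T1.TT N T (\<lambda>x n. tensor_lift T (\<lambda>c m. \<phi> c m n) x)"
proof -
  have "tensor_lift T (\<lambda>c m. \<phi> c m (n \<oplus>\<^bsub>N\<^esub> n')) x =
      tensor_lift T (\<lambda>c m. \<phi> c m n) x \<oplus>\<^bsub>T\<^esub> tensor_lift T (\<lambda>c m. \<phi> c m n') x"
    if "x \<in> carrier T1.TT" "n \<in> carrier N" "n' \<in> carrier N" for x n n'
    using that(1)
    by (induction rule: T1.tensor_induct)
      (simp_all add: that(2,3) inner_pure inner_add inner_closed balanced3_add3 T'.a_ac)
  moreover have "tensor_lift T (\<lambda>c m. \<phi> c m n) (ract_res M x u) = tensor_lift T (\<lambda>c m. \<phi> c m (u \<odot>\<^bsub>N\<^esub> n)) x"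
    if "x \<in> carrier T1.TT" "n \<in> carrier N" "u \<in> carrier MM" for x n u
    using that(1)
    by (induction rule: T1.tensor_induct)
      (simp_all add: that(2,3) inner_pure inner_add ract_res ract_closed balanced3_ract2 N.smult_closed)
  ultimately show ?thesis
    unfolding balanced_def by (simp add: inner_closed inner_add)
qed

lemmas ilift_closed = T.lift_closed [OF T'.M.abelian_group_axioms balanced_outer, folded ilift_def]
  and ilift_add = T.lift_add [OF T'.M.abelian_group_axioms balanced_outer, folded ilift_def]

lemma ilift_ipure:
  assumes "c \<in> carrier MM2" "m \<in> carrier M" "n \<in> carrier N"
  shows "ilift T \<phi> (ipure M N c m n) = \<phi> c m n"
  unfolding ilift_def ipure_def
  using assms
  by (simp add: T.lift_pure [OF T'.M.abelian_group_axioms balanced_outer] inner_pure T1.pure_closed)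

context
  assumes \<phi>_smult: "\<And>u c m n. \<lbrakk>u \<in> carrier MM; c \<in> carrier MM2; m \<in> carrier M; n \<in> carrier N\<rbrakk> \<Longrightarrow>
    \<phi> (u \<odot>\<^bsub>MM2\<^esub> c) m n = u \<odot>\<^bsub>T\<^esub> \<phi> c m n"
begin

lemma ilift_smult:
  assumes "u \<in> carrier MM" "t \<in> carrier (M \<boxtimes> N)"
  shows "ilift T \<phi> (u \<odot>\<^bsub>M \<boxtimes> N\<^esub> t) = u \<odot>\<^bsub>T\<^esub> ilift T \<phi> t"
  using assms(2)
  by (induction rule: itensor_induct)
    (simp_all add: assms(1) ilift_ipure ipure_smult \<phi>_smult MM2.smult_closed
      ilift_add ilift_closed T'.smult_r_distr T.smult_tensor_add T.smult_tensor_closed)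

lemma ilift_hom: "(\<lambda>t\<in>carrier (M \<boxtimes> N). ilift T \<phi> t) \<in> lmod_hom MM (M \<boxtimes> N) T"
  by (rule lmod_homI)
    (simp_all add: ilift_closed ilift_add ilift_smult T.smult_tensor_closed)

end

end

lemma itensor_hom_eqI:
  assumes "f \<in> lmod_hom MM (M \<boxtimes> N) T" "g \<in> lmod_hom MM (M \<boxtimes> N) T"
    and eq: "\<And>c m n. \<lbrakk>c \<in> carrier MM2; m \<in> carrier M; n \<in> carrier N\<rbrakk> \<Longrightarrow>
      f (ipure M N c m n) = g (ipure M N c m n)"
  shows "f = g"
proof (rule lmod_hom_eqI [OF assms(1,2)])
  fix t assume "t \<in> carrier (M \<boxtimes> N)"
  then show "f t = g t"
    by (induction rule: itensor_induct)
      (simp_all add: eq lmod_hom_add [OF assms(1)] lmod_hom_add [OF assms(2)])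
qed

end

end

context
  fixes M :: "(mat, 'm) module"
  assumes M: "left_module MM M"
begin

interpretation M: left_module MM M by (rule M)

text \<open>From here on the module laws are in a form that applies to every iterated tensor
  product, whose module property comes from \<open>left_module_itensor\<close>.\<close>

lemma MM_mod_add_closed: "\<lbrakk>x \<in> carrier M; y \<in> carrier M\<rbrakk> \<Longrightarrow> x \<oplus>\<^bsub>M\<^esub> y \<in> carrier M"
  by simp

lemma MM_mod_add_ac:
  "\<lbrakk>x \<in> carrier M; y \<in> carrier M; x' \<in> carrier M; y' \<in> carrier M\<rbrakk> \<Longrightarrow>
    (x \<oplus>\<^bsub>M\<^esub> y) \<oplus>\<^bsub>M\<^esub> (x' \<oplus>\<^bsub>M\<^esub> y') = (x \<oplus>\<^bsub>M\<^esub> x') \<oplus>\<^bsub>M\<^esub> (y \<oplus>\<^bsub>M\<^esub> y')"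
  by (simp add: M.a_ac)

lemmas MM_mod_smult = M.smult_closed M.smult_l_distr M.smult_r_distr M.smult_assoc1 M.smult_one

end

lemmas MM_mod_simps = MM_mod_add_closed MM_mod_smult left_module_itensor left_module_Zb left_module_MM2
  ring.ring_simprules(1,5,6) [OF ring_MM]
  ract_closed swap_cube_closed assoc_cube_closed pair_cube_closed flat_cube_closed contract_closed unit_closed
  ipure_closed ipure_add1 ipure_add2 ipure_add3 ipure_ract1 ipure_ract2 ipure_smult

declare MM_mod_simps [simp]
  left_module_itensor [intro] left_module_Zb [intro] left_module_MM2 [intro]

text \<open>Additive maps are needed besides linear ones: with c and p fixed, s \<mapsto> (c
  \<otimes> s) \<otimes> p is additive, whereas a scalar on s turns into a right action on
  c.\<close>

lemma itensor_add_hom_ext: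
  assumes "left_module MM M" "left_module MM N" "s \<in> carrier (M \<boxtimes> N)"
    and "\<And>s t. \<lbrakk>s \<in> carrier (M \<boxtimes> N); t \<in> carrier (M \<boxtimes> N)\<rbrakk> \<Longrightarrow> F (s \<oplus>\<^bsub>M \<boxtimes> N\<^esub> t) = F s \<oplus>\<^bsub>T\<^esub> F t"
    and "\<And>s t. \<lbrakk>s \<in> carrier (M \<boxtimes> N); t \<in> carrier (M \<boxtimes> N)\<rbrakk> \<Longrightarrow> G (s \<oplus>\<^bsub>M \<boxtimes> N\<^esub> t) = G s \<oplus>\<^bsub>T\<^esub> G t"
    and "\<And>c m n. \<lbrakk>c \<in> carrier MM2; m \<in> carrier M; n \<in> carrier N\<rbrakk> \<Longrightarrow>
      F (ipure M N c m n) = G (ipure M N c m n)"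
  shows "F s = G s"
  using assms(1-3) by (induction rule: itensor_induct [consumes 3]) (simp_all add: assms(4-6))

lemma itensor_hom_eqI_left:
  assumes "left_module MM M" "left_module MM N" "left_module MM P"
    and f: "f \<in> lmod_hom MM ((M \<boxtimes> N) \<boxtimes> P) T" and g: "g \<in> lmod_hom MM ((M \<boxtimes> N) \<boxtimes> P) T"
    and eq: "\<And>c d m n p. \<lbrakk>c \<in> carrier MM2; d \<in> carrier MM2; m \<in> carrier M; n \<in> carrier N; p \<in> carrier P\<rbrakk> \<Longrightarrow>
      f (ipure (M \<boxtimes> N) P c (ipure M N d m n) p) = g (ipure (M \<boxtimes> N) P c (ipure M N d m n) p)"
  shows "f = g"
proof (rule itensor_hom_eqI [OF _ _ f g])
  fix c s p assume *: "c \<in> carrier MM2" "s \<in> carrier (M \<boxtimes> N)" "p \<in> carrier P"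
  show "f (ipure (M \<boxtimes> N) P c s p) = g (ipure (M \<boxtimes> N) P c s p)"
    by (rule itensor_add_hom_ext [where T = T, OF assms(1,2) *(2)])
      (simp_all add: assms(1-3) * lmod_homD [OF f] lmod_homD [OF g] eq)
qed (simp_all add: assms(1-3))

lemma itensor_hom_eqI_right:
  assumes "left_module MM M" "left_module MM N" "left_module MM P"
    and f: "f \<in> lmod_hom MM (M \<boxtimes> (N \<boxtimes> P)) T" and g: "g \<in> lmod_hom MM (M \<boxtimes> (N \<boxtimes> P)) T"
    and eq: "\<And>c d m n p. \<lbrakk>c \<in> carrier MM2; d \<in> carrier MM2; m \<in> carrier M; n \<in> carrier N; p \<in> carrier P\<rbrakk> \<Longrightarrow>
      f (ipure M (N \<boxtimes> P) c m (ipure N P d n p)) = g (ipure M (N \<boxtimes> P) c m (ipure N P d n p))"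
  shows "f = g"
proof (rule itensor_hom_eqI [OF _ _ f g])
  fix c m s assume *: "c \<in> carrier MM2" "m \<in> carrier M" "s \<in> carrier (N \<boxtimes> P)"
  show "f (ipure M (N \<boxtimes> P) c m s) = g (ipure M (N \<boxtimes> P) c m s)"
    by (rule itensor_add_hom_ext [where T = T, OF assms(2,3) *(3)])
      (simp_all add: assms(1-3) * lmod_homD [OF f] lmod_homD [OF g] eq)
qed (simp_all add: assms(1-3))

lemma itensor_hom_eqI_left2:
  assumes "left_module MM M" "left_module MM N" "left_module MM P" "left_module MM Q"
    and f: "f \<in> lmod_hom MM (((M \<boxtimes> N) \<boxtimes> P) \<boxtimes> Q) T" and g: "g \<in> lmod_hom MM (((M \<boxtimes> N) \<boxtimes> P) \<boxtimes> Q) T"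
    and eq: "\<And>c d e m n p q. \<lbrakk>c \<in> carrier MM2; d \<in> carrier MM2; e \<in> carrier MM2;
        m \<in> carrier M; n \<in> carrier N; p \<in> carrier P; q \<in> carrier Q\<rbrakk> \<Longrightarrow>
      f (ipure ((M \<boxtimes> N) \<boxtimes> P) Q c (ipure (M \<boxtimes> N) P d (ipure M N e m n) p) q) =
      g (ipure ((M \<boxtimes> N) \<boxtimes> P) Q c (ipure (M \<boxtimes> N) P d (ipure M N e m n) p) q)"
  shows "f = g"
proof (rule itensor_hom_eqI_left [OF _ _ _ f g])
  fix c d s p q assume *: "c \<in> carrier MM2" "d \<in> carrier MM2" "s \<in> carrier (M \<boxtimes> N)"
    "p \<in> carrier P" "q \<in> carrier Q"
  show "f (ipure ((M \<boxtimes> N) \<boxtimes> P) Q c (ipure (M \<boxtimes> N) P d s p) q) =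
      g (ipure ((M \<boxtimes> N) \<boxtimes> P) Q c (ipure (M \<boxtimes> N) P d s p) q)"
    by (rule itensor_add_hom_ext [where T = T, OF assms(1,2) *(3)])
      (simp_all add: assms(1-4) * lmod_homD [OF f] lmod_homD [OF g] eq)
qed (simp_all add: assms(1-4))

section \<open>Functoriality and additivity of the internal tensor product\<close>

context
  fixes M :: "(mat, 'm) module" and M' :: "(mat, 'm1) module"
    and N :: "(mat, 'n) module" and N' :: "(mat, 'n1) module"
    and f g
  assumes mods [simp, intro]: "left_module MM M" "left_module MM M'" "left_module MM N" "left_module MM N'"
    and f: "f \<in> lmod_hom MM M M'" and g: "g \<in> lmod_hom MM N N'"
begin

lemma balanced3_itensor_map: "balanced3 M N (M' \<boxtimes> N') (\<lambda>c m n. ipure M' N' c (f m) (g n))"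
  by (simp add: balanced3_def lmod_homD [OF f] lmod_homD [OF g])

lemma itensor_map_hom: "itensor_map M M' N N' f g \<in> lmod_hom MM (M \<boxtimes> N) (M' \<boxtimes> N')"
  unfolding itensor_map_def
  by (rule ilift_hom [OF _ _ _ balanced3_itensor_map]) (simp_all add: lmod_homD [OF f] lmod_homD [OF g])

lemma itensor_map_ipure:
  "\<lbrakk>c \<in> carrier MM2; m \<in> carrier M; n \<in> carrier N\<rbrakk> \<Longrightarrow>
    itensor_map M M' N N' f g (ipure M N c m n) = ipure M' N' c (f m) (g n)"
  by (simp add: itensor_map_def ilift_ipure [OF _ _ _ balanced3_itensor_map])

end

declare itensor_map_hom [simp, intro] itensor_map_ipure [simp]

lemma lmod_id_apply [simp]: "x \<in> carrier M \<Longrightarrow> lmod_id M x = x"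
  by (simp add: lmod_id_def)

lemma compose_apply [simp]: "x \<in> A \<Longrightarrow> compose A g f x = g (f x)"
  by (simp add: compose_def)

lemma hom_add_apply [simp]: "x \<in> carrier M \<Longrightarrow> hom_add M N f g x = f x \<oplus>\<^bsub>N\<^esub> g x"
  by (simp add: hom_add_def)

declare left_module.lmod_id_hom [where R = MM, simp, intro]
  left_module.lmod_hom_compose [where R = MM, intro]
  hom_add_lmod_hom [where R = MM, simp, intro]

lemma itensor_map_id:
  assumes [simp]: "left_module MM M" "left_module MM N"
  shows "itensor_map M M N N (lmod_id M) (lmod_id N) = lmod_id (M \<boxtimes> N)"
  by (rule itensor_hom_eqI [where T = "M \<boxtimes> N" and M = M and N = N]) simp_all

lemma itensor_map_compose:
  assumes [simp, intro]: "left_module MM M" "left_module MM M'" "left_module MM M''"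
      "left_module MM N" "left_module MM N'" "left_module MM N''"
    and f [simp, intro]: "f \<in> lmod_hom MM M M'" and f' [simp, intro]: "f' \<in> lmod_hom MM M' M''"
    and g [simp, intro]: "g \<in> lmod_hom MM N N'" and g' [simp, intro]: "g' \<in> lmod_hom MM N' N''"
  shows "itensor_map M M'' N N'' (compose (carrier M) f' f) (compose (carrier N) g' g) =
    compose (carrier (M \<boxtimes> N)) (itensor_map M' M'' N' N'' f' g') (itensor_map M M' N N' f g)"
proof -
  have [simp]: "compose (carrier M) f' f \<in> lmod_hom MM M M''"
    "compose (carrier N) g' g \<in> lmod_hom MM N N''" by blast+
  show ?thesis
    by (rule itensor_hom_eqI [where T = "M'' \<boxtimes> N''" and M = M and N = N])
      (simp_all add: lmod_homD [OF f] lmod_homD [OF g], blast)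
qed

lemma itensor_map_add1:
  assumes [simp]: "left_module MM M" "left_module MM M'" "left_module MM N" "left_module MM N'"
    and f [simp]: "f \<in> lmod_hom MM M M'" and f' [simp]: "f' \<in> lmod_hom MM M M'"
    and g [simp]: "g \<in> lmod_hom MM N N'"
  shows "itensor_map M M' N N' (hom_add M M' f f') g =
    hom_add (M \<boxtimes> N) (M' \<boxtimes> N') (itensor_map M M' N N' f g) (itensor_map M M' N N' f' g)"
  by (rule itensor_hom_eqI [where T = "M' \<boxtimes> N'" and M = M and N = N])
    (simp_all add: lmod_homD [OF f] lmod_homD [OF f'] lmod_homD [OF g])

lemma itensor_map_add2:
  assumes [simp]: "left_module MM M" "left_module MM M'" "left_module MM N" "left_module MM N'"
    and f [simp]: "f \<in> lmod_hom MM M M'" and g [simp]: "g \<in> lmod_hom MM N N'"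
    and g' [simp]: "g' \<in> lmod_hom MM N N'"
  shows "itensor_map M M' N N' f (hom_add N N' g g') =
    hom_add (M \<boxtimes> N) (M' \<boxtimes> N') (itensor_map M M' N N' f g) (itensor_map M M' N N' f g')"
  by (rule itensor_hom_eqI [where T = "M' \<boxtimes> N'" and M = M and N = N])
    (simp_all add: lmod_homD [OF f] lmod_homD [OF g] lmod_homD [OF g'])

section \<open>The braiding\<close>

context
  fixes M :: "(mat, 'm) module" and N :: "(mat, 'n) module"
  assumes mods [simp, intro]: "left_module MM M" "left_module MM N"
begin

lemma balanced3_braid: "balanced3 M N (N \<boxtimes> M) (\<lambda>c m n. ipure N M (swap_cube c) n m)"
  by (simp add: balanced3_def swap_cube_ops)

lemma braid_eq: "braid M N =
    (\<lambda>t\<in>carrier (M \<boxtimes> N). ilift (N \<boxtimes> M) (\<lambda>c m n. ipure N M (swap_cube c) n m) t)"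
  by (simp add: braid_def swap_cube_def)

lemma braid_hom: "braid M N \<in> lmod_hom MM (M \<boxtimes> N) (N \<boxtimes> M)"
  unfolding braid_eq by (rule ilift_hom [OF _ _ _ balanced3_braid]) (simp_all add: swap_cube_ops)

lemma braid_ipure:
  "\<lbrakk>c \<in> carrier MM2; m \<in> carrier M; n \<in> carrier N\<rbrakk> \<Longrightarrow>
    braid M N (ipure M N c m n) = ipure N M (swap_cube c) n m"
  by (simp add: braid_eq ilift_ipure [OF _ _ _ balanced3_braid])

end

declare braid_hom [simp, intro] braid_ipure [simp]

lemma braid_braid:
  assumes [simp, intro]: "left_module MM M" "left_module MM N"
  shows "compose (carrier (M \<boxtimes> N)) (braid N M) (braid M N) = lmod_id (M \<boxtimes> N)"
  by (rule itensor_hom_eqI [where T = "M \<boxtimes> N" and M = M and N = N]) (simp_all add: swap_cube_ops, blast)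

lemma braid_iso:
  assumes [simp, intro]: "left_module MM M" "left_module MM N"
  shows "braid M N \<in> lmod_iso MM (M \<boxtimes> N) (N \<boxtimes> M)"
  by (rule lmod_isoI [where g = "braid N M"]) (simp_all add: braid_braid)

text \<open>Used for the right unit, which is a braiding followed by the left unit.\<close>

lemma lmod_iso_compose:
  assumes "left_module MM L" "left_module MM M" "left_module MM N"
    and f: "f \<in> lmod_iso MM L M" and g: "g \<in> lmod_iso MM M N"
  shows "compose (carrier L) g f \<in> lmod_iso MM L N"
proof -
  obtain f' where f': "f' \<in> lmod_hom MM M L" "compose (carrier L) f' f = lmod_id L"
      "compose (carrier M) f f' = lmod_id M" and fh: "f \<in> lmod_hom MM L M"
    using f unfolding lmod_iso_def by blast
  obtain g' where g': "g' \<in> lmod_hom MM N M" "compose (carrier M) g' g = lmod_id M"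
      "compose (carrier N) g g' = lmod_id N" and gh: "g \<in> lmod_hom MM M N"
    using g unfolding lmod_iso_def by blast
  note [intro] = assms(1-3) f'(1) g'(1) fh gh
  note [simp] = assms(1-3) f'(1) g'(1) fh gh lmod_homD [OF f'(1)] lmod_homD [OF g'(1)]
    lmod_homD [OF fh] lmod_homD [OF gh]
  have inv: "x \<in> carrier L \<Longrightarrow> f' (f x) = x" "z \<in> carrier N \<Longrightarrow> g (g' z) = z"
    "y \<in> carrier M \<Longrightarrow> f (f' y) = y" "y \<in> carrier M \<Longrightarrow> g' (g y) = y" for x y z
    using fun_cong [OF f'(2), of x] fun_cong [OF g'(3), of z] fun_cong [OF f'(3), of y]
      fun_cong [OF g'(2), of y] by simp_all
  have "compose (carrier L) (compose (carrier N) f' g') (compose (carrier L) g f) = lmod_id L"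
    by (rule lmod_hom_eqI [where M = L and N = L and R = MM]) (blast, blast, simp add: inv)
  moreover have "compose (carrier N) (compose (carrier L) g f) (compose (carrier N) f' g') = lmod_id N"
    by (rule lmod_hom_eqI [where M = N and N = N and R = MM]) (blast, blast, simp add: inv)
  ultimately show ?thesis
    by (intro lmod_isoI [where g = "compose (carrier N) f' g'"]) blast+
qed

section \<open>The unit isomorphisms\<close>

context
  fixes M :: "(mat, 'm) module"
  assumes M [simp, intro]: "left_module MM M"
begin

lemma balanced3_lunit: "balanced3 Zb M M (\<lambda>c z m. contract1 c z \<odot>\<^bsub>M\<^esub> m)"
  by (simp add: balanced3_def contract_add contract_mult)

lemma lunit_hom: "lunit M \<in> lmod_hom MM (Zb \<boxtimes> M) M"
  unfolding lunit_def by (rule ilift_hom [OF _ _ _ balanced3_lunit]) (simp_all add: contract_mult)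

lemma lunit_ipure:
  "\<lbrakk>c \<in> carrier MM2; z \<in> carrier Zb; m \<in> carrier M\<rbrakk> \<Longrightarrow>
    lunit M (ipure Zb M c z m) = contract1 c z \<odot>\<^bsub>M\<^esub> m"
  by (simp add: lunit_def ilift_ipure [OF _ _ _ balanced3_lunit])

lemma balanced3_runit: "balanced3 M Zb M (\<lambda>c m z. contract2 c z \<odot>\<^bsub>M\<^esub> m)"
  by (simp add: balanced3_def contract2_swap contract_add contract_mult swap_cube_ops)

lemma runit_hom: "runit M \<in> lmod_hom MM (M \<boxtimes> Zb) M"
  unfolding runit_def
  by (rule ilift_hom [OF _ _ _ balanced3_runit])
    (simp_all add: contract2_swap contract_mult swap_cube_ops)

lemma runit_ipure:
  "\<lbrakk>c \<in> carrier MM2; z \<in> carrier Zb; m \<in> carrier M\<rbrakk> \<Longrightarrow>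
    runit M (ipure M Zb c m z) = contract2 c z \<odot>\<^bsub>M\<^esub> m"
  by (simp add: runit_def ilift_ipure [OF _ _ _ balanced3_runit])

end

declare lunit_hom [simp, intro] lunit_ipure [simp] runit_hom [simp, intro] runit_ipure [simp]

context
  fixes M :: "(mat, 'm) module"
  assumes M [simp, intro]: "left_module MM M"
begin

text \<open>Write z = \<open>column_mat z\<close> \<cdot> \<open>unit_vec\<close>, move the matrix
  to c, turn it into a second right action on \<open>unit_cube\<close> and pass that on to m. In
  this normal form the image under \<open>lunit\<close> determines the element.\<close>

lemma ipure_unit:
  assumes [simp]: "c \<in> carrier MM2" "z \<in> carrier Zb" "m \<in> carrier M"
  shows "ipure Zb M c z m = ipure Zb M unit_cube unit_vec (contract1 c z \<odot>\<^bsub>M\<^esub> m)"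
proof -
  have "ipure Zb M c z m = ipure Zb M c (column_mat z \<odot>\<^bsub>Zb\<^esub> unit_vec) m"
    by (simp add: column_mat)
  also have "\<dots> = ipure Zb M (ract2 unit_cube (contract1 c z)) unit_vec m"
    unfolding ract1_column_mat [OF assms(1,2), symmetric] by (simp add: column_mat)
  finally show ?thesis by simp
qed

lemma lunit_iso: "lunit M \<in> lmod_iso MM (Zb \<boxtimes> M) M"
proof -
  define h where "h = (\<lambda>m\<in>carrier M. ipure Zb M unit_cube unit_vec m)"
  have h [simp]: "h m = ipure Zb M unit_cube unit_vec m" if "m \<in> carrier M" for m
    using that by (simp add: h_def)
  have hom [simp, intro]: "h \<in> lmod_hom MM M (Zb \<boxtimes> M)"
  proof (rule lmod_homI)
    fix u m assume [simp]: "u \<in> carrier MM" "m \<in> carrier M"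
    \<comment> \<open>Linearity of h: u travels from m to \<open>unit_cube\<close> by the second
      right action, where it coincides with left multiplication.\<close>
    have "ipure Zb M unit_cube unit_vec (u \<odot>\<^bsub>M\<^esub> m) = ipure Zb M (ract2 unit_cube u) unit_vec m"
      by simp
    then show "h (u \<odot>\<^bsub>M\<^esub> m) = u \<odot>\<^bsub>Zb \<boxtimes> M\<^esub> h m"
      by (simp add: ract2_unit_cube del: ipure_ract2)
  qed (simp_all add: h_def)
  show ?thesis
  proof (rule lmod_isoI [where g = h])
    show "compose (carrier (Zb \<boxtimes> M)) h (lunit M) = lmod_id (Zb \<boxtimes> M)"
      by (rule itensor_hom_eqI [where M = Zb and N = M and T = "Zb \<boxtimes> M"])
        (blast, blast, blast, blast, simp add: ipure_unit [symmetric])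
    show "compose (carrier M) (lunit M) h = lmod_id M"
      by (rule lmod_hom_eqI [where M = M and N = M and R = MM])
        (blast, blast, simp add: contract1_unit)
  qed simp_all
qed

lemma runit_iso: "runit M \<in> lmod_iso MM (M \<boxtimes> Zb) M"
proof -
  \<comment> \<open>Contracting the third index is contracting the second one after
    \<open>swap_cube\<close>.\<close>
  have "runit M = compose (carrier (M \<boxtimes> Zb)) (lunit M) (braid M Zb)"
    by (rule itensor_hom_eqI [where M = M and N = Zb and T = M]) (blast, blast, blast, blast, simp add: contract2_swap)
  then show ?thesis
    using lmod_iso_compose [OF _ _ _ braid_iso lunit_iso] by simp
qed

end

section \<open>The associator\<close>

declare flat_cube_pair_cube [simp]

context
  fixes M :: "(mat, 'm) module" and N :: "(mat, 'n) module" and P :: "(mat, 'p) module"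
  assumes mods [simp, intro]: "left_module MM M" "left_module MM N" "left_module MM P"
begin

lemma balanced3_assoc_inner:
  assumes "c \<in> carrier MM2" "p \<in> carrier P"
  shows "balanced3 M N (M \<boxtimes> (N \<boxtimes> P))
    (\<lambda>d m n. ipure M (N \<boxtimes> P) (assoc_cube c d) m (ipure N P pair_cube n p))"
  using assms by (simp add: balanced3_def assoc_cube_add_right assoc_cube_ract1 assoc_cube_ract2)

definition assoc_inner :: "cube \<Rightarrow> ('m, 'n) itens \<Rightarrow> 'p \<Rightarrow> ('m, ('n, 'p) itens) itens"
  where "assoc_inner = (\<lambda>c s p. ilift (M \<boxtimes> (N \<boxtimes> P))
    (\<lambda>d m n. ipure M (N \<boxtimes> P) (assoc_cube c d) m (ipure N P pair_cube n p)) s)"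

lemma assoc_inner:
  assumes "c \<in> carrier MM2" "p \<in> carrier P"
  shows "s \<in> carrier (M \<boxtimes> N) \<Longrightarrow> assoc_inner c s p \<in> carrier (M \<boxtimes> (N \<boxtimes> P))"
    and "\<lbrakk>s \<in> carrier (M \<boxtimes> N); t \<in> carrier (M \<boxtimes> N)\<rbrakk> \<Longrightarrow>
      assoc_inner c (s \<oplus>\<^bsub>M \<boxtimes> N\<^esub> t) p = assoc_inner c s p \<oplus>\<^bsub>M \<boxtimes> (N \<boxtimes> P)\<^esub> assoc_inner c t p"
    and "\<lbrakk>d \<in> carrier MM2; m \<in> carrier M; n \<in> carrier N\<rbrakk> \<Longrightarrow>
      assoc_inner c (ipure M N d m n) p = ipure M (N \<boxtimes> P) (assoc_cube c d) m (ipure N P pair_cube n p)"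
  using ilift_closed [OF mods(1,2) _ balanced3_assoc_inner [OF assms]]
    ilift_add [OF mods(1,2) _ balanced3_assoc_inner [OF assms]]
    ilift_ipure [OF mods(1,2) _ balanced3_assoc_inner [OF assms]]
  by (simp_all add: assoc_inner_def)

text \<open>Additivity in s is built into the inner lift. In each other law both sides are additive
  in s, so s may be taken pure, and there the law is one of \<open>assoc_cube\<close> or
  \<open>ipure\<close>.\<close>

lemma balanced3_assoc: "balanced3 (M \<boxtimes> N) P (M \<boxtimes> (N \<boxtimes> P)) assoc_inner"
  and assoc_inner_smult: "\<lbrakk>u \<in> carrier MM; c \<in> carrier MM2; s \<in> carrier (M \<boxtimes> N); p \<in> carrier P\<rbrakk> \<Longrightarrow>
    assoc_inner (u \<odot>\<^bsub>MM2\<^esub> c) s p = u \<odot>\<^bsub>M \<boxtimes> (N \<boxtimes> P)\<^esub> assoc_inner c s p"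
proof -
  let ?T = "M \<boxtimes> (N \<boxtimes> P)"
  note ext = itensor_add_hom_ext [where T = "?T", OF mods(1,2)]
  have "assoc_inner (c \<oplus>\<^bsub>MM2\<^esub> c') s p = assoc_inner c s p \<oplus>\<^bsub>?T\<^esub> assoc_inner c' s p"
    if "c \<in> carrier MM2" "c' \<in> carrier MM2" "p \<in> carrier P" "s \<in> carrier (M \<boxtimes> N)" for c c' p s
    by (rule ext [OF that(4)]) (simp_all add: that assoc_inner assoc_cube_add_left MM_mod_add_ac)
  moreover have "assoc_inner c s (p \<oplus>\<^bsub>P\<^esub> p') = assoc_inner c s p \<oplus>\<^bsub>?T\<^esub> assoc_inner c s p'"
    if "c \<in> carrier MM2" "p' \<in> carrier P" "p \<in> carrier P" "s \<in> carrier (M \<boxtimes> N)" for c p p' s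
    by (rule ext [OF that(4)]) (simp_all add: that assoc_inner MM_mod_add_ac)
  moreover have "assoc_inner (ract1 c u) s p = assoc_inner c (u \<odot>\<^bsub>M \<boxtimes> N\<^esub> s) p"
    if "c \<in> carrier MM2" "u \<in> carrier MM" "p \<in> carrier P" "s \<in> carrier (M \<boxtimes> N)" for c u p s
    by (rule ext [OF that(4)]) (simp_all add: that assoc_inner assoc_cube_ract1)
  moreover have "assoc_inner (ract2 c u) s p = assoc_inner c s (u \<odot>\<^bsub>P\<^esub> p)"
    if "c \<in> carrier MM2" "u \<in> carrier MM" "p \<in> carrier P" "s \<in> carrier (M \<boxtimes> N)" for c u p s
    by (rule ext [OF that(4)]) (simp_all add: that assoc_inner assoc_cube_ract2)
  ultimately show "balanced3 (M \<boxtimes> N) P (M \<boxtimes> (N \<boxtimes> P)) assoc_inner"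
    unfolding balanced3_def by (simp add: assoc_inner)
  show "assoc_inner (u \<odot>\<^bsub>MM2\<^esub> c) s p = u \<odot>\<^bsub>?T\<^esub> assoc_inner c s p"
    if "u \<in> carrier MM" "c \<in> carrier MM2" "s \<in> carrier (M \<boxtimes> N)" "p \<in> carrier P"
    by (rule ext [OF that(3)]) (simp_all add: that assoc_inner assoc_cube_smult)
qed

lemma assoc_eq: "assoc M N P = (\<lambda>t\<in>carrier ((M \<boxtimes> N) \<boxtimes> P). ilift (M \<boxtimes> (N \<boxtimes> P)) assoc_inner t)"
  by (simp add: assoc_def assoc_inner_def)

lemma assoc_hom: "assoc M N P \<in> lmod_hom MM ((M \<boxtimes> N) \<boxtimes> P) (M \<boxtimes> (N \<boxtimes> P))"
  unfolding assoc_eq by (rule ilift_hom [OF _ _ _ balanced3_assoc]) (simp_all add: assoc_inner_smult)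

lemma assoc_ipure:
  "\<lbrakk>c \<in> carrier MM2; d \<in> carrier MM2; m \<in> carrier M; n \<in> carrier N; p \<in> carrier P\<rbrakk> \<Longrightarrow>
    assoc M N P (ipure (M \<boxtimes> N) P c (ipure M N d m n) p) =
    ipure M (N \<boxtimes> P) (assoc_cube c d) m (ipure N P pair_cube n p)"
  by (simp add: assoc_eq ilift_ipure [OF _ _ _ balanced3_assoc] assoc_inner)

end

declare assoc_hom [simp, intro] assoc_ipure [simp]

lemmas hom_intros = left_module.lmod_hom_compose [where R = MM] itensor_map_hom braid_hom
  assoc_hom lunit_hom runit_hom left_module.lmod_id_hom [where R = MM] left_module_itensor left_module_Zb

section \<open>Invertibility of the associator\<close>

context
  fixes M :: "(mat, 'm) module" and N :: "(mat, 'n) module" and P :: "(mat, 'p) module"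
  assumes mods [simp, intro]: "left_module MM M" "left_module MM N" "left_module MM P"
begin

lemma ipure_right_flat:
  assumes "c \<in> carrier MM2" "d \<in> carrier MM2" "m \<in> carrier M" "n \<in> carrier N" "p \<in> carrier P"
  shows "ipure M (N \<boxtimes> P) c m (ipure N P d n p) =
    ipure M (N \<boxtimes> P) (ract2 c (flat_cube d)) m (ipure N P pair_cube n p)"
  using assms by simp

text \<open>Since \<open>swap_cube\<close> is a left linear automorphism of \<open>MM2\<close>,
  \<open>swap_cube pair_cube\<close> is a generator as well; it is the one that
  \<open>assoc_inv\<close> leaves in the inner factor.\<close>

lemma ipure_left_flat:
  assumes "c \<in> carrier MM2" "d \<in> carrier MM2" "m \<in> carrier M" "n \<in> carrier N" "p \<in> carrier P"
  shows "ipure (M \<boxtimes> N) P c (ipure M N d m n) p =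
    ipure (M \<boxtimes> N) P (ract1 c (flat_cube (swap_cube d))) (ipure M N (swap_cube pair_cube) m n) p"
proof -
  have "flat_cube (swap_cube d) \<odot>\<^bsub>MM2\<^esub> swap_cube pair_cube = d"
    by (simp add: swap_cube_ops flip: swap_cube_ops(3))
  then show ?thesis
    using assms by simp
qed

text \<open>Reversing the order of the factors turns the associator into its inverse.\<close>

definition assoc_inv :: "('m, ('n, 'p) itens) itens \<Rightarrow> (('m, 'n) itens, 'p) itens"
  where "assoc_inv = compose (carrier (M \<boxtimes> (N \<boxtimes> P)))
    (compose (carrier ((P \<boxtimes> N) \<boxtimes> M))
      (compose (carrier (P \<boxtimes> (N \<boxtimes> M))) (braid P (M \<boxtimes> N))
        (itensor_map P P (N \<boxtimes> M) (M \<boxtimes> N) (lmod_id P) (braid N M)))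
      (assoc P N M))
    (compose (carrier (M \<boxtimes> (N \<boxtimes> P)))
      (itensor_map (N \<boxtimes> P) (P \<boxtimes> N) M M (braid N P) (lmod_id M)) (braid M (N \<boxtimes> P)))"

lemma assoc_inv_hom: "assoc_inv \<in> lmod_hom MM (M \<boxtimes> (N \<boxtimes> P)) ((M \<boxtimes> N) \<boxtimes> P)"
  unfolding assoc_inv_def
  by (rule hom_intros mods)+

lemma assoc_inv_ipure:
  "\<lbrakk>c \<in> carrier MM2; d \<in> carrier MM2; m \<in> carrier M; n \<in> carrier N; p \<in> carrier P\<rbrakk> \<Longrightarrow>
    assoc_inv (ipure M (N \<boxtimes> P) c m (ipure N P d n p)) =
    ipure (M \<boxtimes> N) P (swap_cube (assoc_cube (swap_cube c) (swap_cube d)))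
      (ipure M N (swap_cube pair_cube) m n) p"
  by (simp add: assoc_inv_def)

lemma assoc_iso: "assoc M N P \<in> lmod_iso MM ((M \<boxtimes> N) \<boxtimes> P) (M \<boxtimes> (N \<boxtimes> P))"
proof (rule lmod_isoI [OF assoc_hom [OF mods] assoc_inv_hom])
  \<comment> \<open>By \<open>swap_assoc_cube_swap\<close> the round trip has moved the coordinate
    of d with respect to \<open>swap_cube pair_cube\<close> onto c; moving it back gives the
    original element.\<close>
  have left: "ipure (M \<boxtimes> N) P (swap_cube (assoc_cube (swap_cube (assoc_cube c d)) (swap_cube pair_cube)))
      (ipure M N (swap_cube pair_cube) m n) p = ipure (M \<boxtimes> N) P c (ipure M N d m n) p"
    if "c \<in> carrier MM2" "d \<in> carrier MM2" "m \<in> carrier M" "n \<in> carrier N" "p \<in> carrier P"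
    for c d m n p
    unfolding swap_assoc_cube_swap using ipure_left_flat [OF that] by simp
  show "compose (carrier ((M \<boxtimes> N) \<boxtimes> P)) assoc_inv (assoc M N P) = lmod_id ((M \<boxtimes> N) \<boxtimes> P)"
    by (rule itensor_hom_eqI_left [where T = "(M \<boxtimes> N) \<boxtimes> P" and M = M and N = N and P = P];
        ((rule hom_intros assoc_inv_hom mods)+)?)
      (simp add: assoc_inv_ipure left)
  have right: "ipure M (N \<boxtimes> P) (assoc_cube (swap_cube (assoc_cube (swap_cube c) (swap_cube d))) (swap_cube pair_cube)) m
      (ipure N P pair_cube n p) = ipure M (N \<boxtimes> P) c m (ipure N P d n p)"
    if "c \<in> carrier MM2" "d \<in> carrier MM2" "m \<in> carrier M" "n \<in> carrier N" "p \<in> carrier P"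
    for c d m n p
    unfolding assoc_cube_swap_swap using ipure_right_flat [OF that] by simp
  show "compose (carrier (M \<boxtimes> (N \<boxtimes> P))) (assoc M N P) assoc_inv = lmod_id (M \<boxtimes> (N \<boxtimes> P))"
    by (rule itensor_hom_eqI_right [where T = "M \<boxtimes> (N \<boxtimes> P)" and M = M and N = N and P = P];
        ((rule hom_intros assoc_inv_hom mods)+)?)
      (simp add: assoc_inv_ipure right)
qed

end

section \<open>Naturality of the structural maps and the coherence diagrams\<close>

lemma lunit_natural:
  assumes [simp]: "left_module MM M" "left_module MM M'" and f: "f \<in> lmod_hom MM M M'"
  shows "compose (carrier (Zb \<boxtimes> M)) f (lunit M) =
    compose (carrier (Zb \<boxtimes> M)) (lunit M') (itensor_map Zb Zb M M' (lmod_id Zb) f)"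
  by (rule itensor_hom_eqI [where M = Zb and N = M and T = M'];
      ((rule hom_intros f assms(1,2))+)?)
    (simp add: f lmod_homD [OF f])

lemma runit_natural:
  assumes [simp]: "left_module MM M" "left_module MM M'" and f: "f \<in> lmod_hom MM M M'"
  shows "compose (carrier (M \<boxtimes> Zb)) f (runit M) =
    compose (carrier (M \<boxtimes> Zb)) (runit M') (itensor_map M M' Zb Zb f (lmod_id Zb))"
  by (rule itensor_hom_eqI [where M = M and N = Zb and T = M'];
      ((rule hom_intros f assms(1,2))+)?)
    (simp add: f lmod_homD [OF f])

lemma braid_natural:
  assumes [simp]: "left_module MM M" "left_module MM M'" "left_module MM N" "left_module MM N'"
    and f: "f \<in> lmod_hom MM M M'" and g: "g \<in> lmod_hom MM N N'"
  shows "compose (carrier (M \<boxtimes> N)) (itensor_map N N' M M' g f) (braid M N) =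
    compose (carrier (M \<boxtimes> N)) (braid M' N') (itensor_map M M' N N' f g)"
  by (rule itensor_hom_eqI [where M = M and N = N and T = "N' \<boxtimes> M'"];
      ((rule hom_intros f g assms(1-4))+)?)
    (simp add: f g lmod_homD [OF f] lmod_homD [OF g])

lemma assoc_natural:
  assumes [simp]: "left_module MM M" "left_module MM M'" "left_module MM N" "left_module MM N'"
    "left_module MM P" "left_module MM P'"
    and f: "f \<in> lmod_hom MM M M'" and g: "g \<in> lmod_hom MM N N'" and h: "h \<in> lmod_hom MM P P'"
  shows "compose (carrier ((M \<boxtimes> N) \<boxtimes> P))
      (itensor_map M M' (N \<boxtimes> P) (N' \<boxtimes> P') f (itensor_map N N' P P' g h)) (assoc M N P) =
    compose (carrier ((M \<boxtimes> N) \<boxtimes> P))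
      (assoc M' N' P') (itensor_map (M \<boxtimes> N) (M' \<boxtimes> N') P P' (itensor_map M M' N N' f g) h)"
  by (rule itensor_hom_eqI_left [where M = M and N = N and P = P and T = "M' \<boxtimes> (N' \<boxtimes> P')"];
      ((rule hom_intros f g h assms(1-6))+)?)
    (simp add: f g h lmod_homD [OF f] lmod_homD [OF g] lmod_homD [OF h])

text \<open>On pure tensors the second route ends with \<open>assoc_cube pair_cube pair_cube\<close>
  in the factor N \<boxtimes> (P \<boxtimes> Q), the first with \<open>pair_cube\<close>. By
  \<open>assoc_cube_pentagon\<close> the recoding matrix appears on the outer cube of the first and
  crosses to \<open>pair_cube\<close>, giving the cube of the second.\<close>

lemma pentagon:
  assumes mods [simp]: "left_module MM M" "left_module MM N" "left_module MM P" "left_module MM Q"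
  shows "compose (carrier (((M \<boxtimes> N) \<boxtimes> P) \<boxtimes> Q)) (assoc M N (P \<boxtimes> Q)) (assoc (M \<boxtimes> N) P Q) =
    compose (carrier (((M \<boxtimes> N) \<boxtimes> P) \<boxtimes> Q))
      (itensor_map M M ((N \<boxtimes> P) \<boxtimes> Q) (N \<boxtimes> (P \<boxtimes> Q)) (lmod_id M) (assoc N P Q))
      (compose (carrier (((M \<boxtimes> N) \<boxtimes> P) \<boxtimes> Q))
        (assoc M (N \<boxtimes> P) Q)
        (itensor_map ((M \<boxtimes> N) \<boxtimes> P) (M \<boxtimes> (N \<boxtimes> P)) Q Q (assoc M N P) (lmod_id Q)))"
  by (rule itensor_hom_eqI_left2 [where M = M and N = N and P = P and Q = Q
        and T = "M \<boxtimes> (N \<boxtimes> (P \<boxtimes> Q))"];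
      ((rule hom_intros mods)+)?)
    (simp add: assoc_cube_pentagon)

lemma triangle:
  assumes mods [simp]: "left_module MM M" "left_module MM N"
  shows "compose (carrier ((M \<boxtimes> Zb) \<boxtimes> N))
      (itensor_map M M (Zb \<boxtimes> N) N (lmod_id M) (lunit N)) (assoc M Zb N) =
    itensor_map (M \<boxtimes> Zb) M N N (runit M) (lmod_id N)"
proof (rule itensor_hom_eqI_left [where M = M and N = Zb and P = N and T = "M \<boxtimes> N"];
      ((rule hom_intros mods)+)?)
  fix c d m z n
  assume [simp]: "c \<in> carrier MM2" "d \<in> carrier MM2" "m \<in> carrier M" "z \<in> carrier Zb" "n \<in> carrier N"
  \<comment> \<open>\<open>lunit\<close> contracts \<open>pair_cube\<close> with z and acts on n,
    \<open>runit\<close> contracts d with z and acts on m. Bringing both actions back to the outer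
    cube reduces the triangle to \<open>assoc_cube_triangle\<close>.\<close>
  have "ipure M N (ract2 (assoc_cube c d) (contract1 pair_cube z)) m n =
      ipure M N (ract1 c (contract2 d z)) m n"
    by (simp add: assoc_cube_triangle del: ipure_ract1 ipure_ract2)
  then show "compose (carrier ((M \<boxtimes> Zb) \<boxtimes> N))
      (itensor_map M M (Zb \<boxtimes> N) N (lmod_id M) (lunit N)) (assoc M Zb N)
        (ipure (M \<boxtimes> Zb) N c (ipure M Zb d m z) n) =
    itensor_map (M \<boxtimes> Zb) M N N (runit M) (lmod_id N) (ipure (M \<boxtimes> Zb) N c (ipure M Zb d m z) n)"
    by simp
qed

lemma hexagon:
  assumes mods [simp]: "left_module MM M" "left_module MM N" "left_module MM P"
  shows "compose (carrier ((M \<boxtimes> N) \<boxtimes> P))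
     (assoc N P M)
     (compose (carrier ((M \<boxtimes> N) \<boxtimes> P)) (braid M (N \<boxtimes> P)) (assoc M N P)) =
   compose (carrier ((M \<boxtimes> N) \<boxtimes> P))
     (itensor_map N N (M \<boxtimes> P) (P \<boxtimes> M) (lmod_id N) (braid M P))
     (compose (carrier ((M \<boxtimes> N) \<boxtimes> P))
       (assoc N M P)
       (itensor_map (M \<boxtimes> N) (N \<boxtimes> M) P P (braid M N) (lmod_id P)))"
  by (rule itensor_hom_eqI_left [where M = M and N = N and P = P and T = "N \<boxtimes> (P \<boxtimes> M)"];
      ((rule hom_intros mods)+)?)
    (simp add: assoc_cube_hexagon)

section \<open>Internal Hom\<close>

lemma (in left_module) smult_a_inv:
  assumes "a \<in> carrier R" "x \<in> carrier M"
  shows "a \<odot>\<^bsub>M\<^esub> (\<ominus>\<^bsub>M\<^esub> x) = \<ominus>\<^bsub>M\<^esub> (a \<odot>\<^bsub>M\<^esub> x)"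
proof -
  have "a \<odot>\<^bsub>M\<^esub> (\<ominus>\<^bsub>M\<^esub> x) \<oplus>\<^bsub>M\<^esub> a \<odot>\<^bsub>M\<^esub> x = \<zero>\<^bsub>M\<^esub>"
    using smult_r_distr [of a "\<ominus>\<^bsub>M\<^esub> x" x] assms by (simp add: M.l_neg smult_zero)
  then show ?thesis
    using assms by (intro M.minus_equality [symmetric]) (simp_all add: smult_closed)
qed

abbreviation tensor2 :: "(mat, 'n) module \<Rightarrow> (mat, (cube, 'n) tens) module"
  where "tensor2 N \<equiv> tensor MM ract2 MM2 N"

abbreviation pure2 :: "(mat, 'n) module \<Rightarrow> cube \<Rightarrow> 'n \<Rightarrow> (cube, 'n) tens"
  where "pure2 N \<equiv> tensor_pure MM ract2 MM2 N"

text \<open>The right structure of \<open>MM2\<close> left over by the tensor product with N; it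
  descends because the two right structures commute.\<close>

definition right_mult :: "(mat, 'n) module \<Rightarrow> mat \<Rightarrow> (cube, 'n) tens \<Rightarrow> (cube, 'n) tens"
  where "right_mult N u = tensor_endo MM ract2 MM2 N (\<lambda>c. ract1 c u)"

lemma ihom_simps:
  "carrier (ihom N P) = lmod_hom MM (tensor2 N) P"
  "\<zero>\<^bsub>ihom N P\<^esub> = (\<lambda>t\<in>carrier (tensor2 N). \<zero>\<^bsub>P\<^esub>)"
  "h \<oplus>\<^bsub>ihom N P\<^esub> h' = hom_add (tensor2 N) P h h'"
  "u \<odot>\<^bsub>ihom N P\<^esub> h = (\<lambda>t\<in>carrier (tensor2 N). h (right_mult N u t))"
  by (simp_all add: ihom_def Let_def right_mult_def tensor_endo_def)

context
  fixes N :: "(mat, 'n) module"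
  assumes N [simp, intro]: "left_module MM N"
begin

interpretation T: tensor_module MM MM ract2 MM2 N
  by (rule tensor_module_ract2 [OF N])

lemma left_module_tensor2 [simp, intro]: "left_module MM (tensor2 N)"
  by (rule T.left_module_tensor)

lemma pure2 [simp]:
  assumes "c \<in> carrier MM2" "n \<in> carrier N"
  shows "pure2 N c n \<in> carrier (tensor2 N)"
    and "c' \<in> carrier MM2 \<Longrightarrow> pure2 N (c \<oplus>\<^bsub>MM2\<^esub> c') n = pure2 N c n \<oplus>\<^bsub>tensor2 N\<^esub> pure2 N c' n"
    and "n' \<in> carrier N \<Longrightarrow> pure2 N c (n \<oplus>\<^bsub>N\<^esub> n') = pure2 N c n \<oplus>\<^bsub>tensor2 N\<^esub> pure2 N c n'"
    and "u \<in> carrier MM \<Longrightarrow> pure2 N (ract2 c u) n = pure2 N c (u \<odot>\<^bsub>N\<^esub> n)"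
    and "u \<in> carrier MM \<Longrightarrow> u \<odot>\<^bsub>tensor2 N\<^esub> pure2 N c n = pure2 N (u \<odot>\<^bsub>MM2\<^esub> c) n"
  using assms
  by (simp_all add: T.pure_closed T.pure_add_left T.pure_add_right T.pure_act T.smult_pure)

lemma right_mult:
  assumes "u \<in> carrier MM"
  shows "\<lbrakk>c \<in> carrier MM2; n \<in> carrier N\<rbrakk> \<Longrightarrow> right_mult N u (pure2 N c n) = pure2 N (ract1 c u) n"
    and "t \<in> carrier (tensor2 N) \<Longrightarrow> right_mult N u t \<in> carrier (tensor2 N)"
    and "\<lbrakk>s \<in> carrier (tensor2 N); t \<in> carrier (tensor2 N)\<rbrakk> \<Longrightarrow>
      right_mult N u (s \<oplus>\<^bsub>tensor2 N\<^esub> t) = right_mult N u s \<oplus>\<^bsub>tensor2 N\<^esub> right_mult N u t"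
    and "\<lbrakk>v \<in> carrier MM; t \<in> carrier (tensor2 N)\<rbrakk> \<Longrightarrow>
      right_mult N u (v \<odot>\<^bsub>tensor2 N\<^esub> t) = v \<odot>\<^bsub>tensor2 N\<^esub> right_mult N u t"
  unfolding right_mult_def
     apply (rule T.endo_pure; simp add: assms ract_add ract_commute)
    apply (rule T.endo_closed; simp add: assms ract_add ract_commute)
   apply (rule T.endo_add; simp add: assms ract_add ract_commute)
  apply (rule T.endo_smult; simp add: assms ract_add ract_commute smult_ract)
  done

lemma tensor2_additive_eq:
  assumes "t \<in> carrier (tensor2 N)"
    and "\<And>s t. \<lbrakk>s \<in> carrier (tensor2 N); t \<in> carrier (tensor2 N)\<rbrakk> \<Longrightarrow> f (s \<oplus>\<^bsub>tensor2 N\<^esub> t) = f s \<oplus>\<^bsub>P\<^esub> f t"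
    and "\<And>s t. \<lbrakk>s \<in> carrier (tensor2 N); t \<in> carrier (tensor2 N)\<rbrakk> \<Longrightarrow> g (s \<oplus>\<^bsub>tensor2 N\<^esub> t) = g s \<oplus>\<^bsub>P\<^esub> g t"
    and "\<And>c n. \<lbrakk>c \<in> carrier MM2; n \<in> carrier N\<rbrakk> \<Longrightarrow> f (pure2 N c n) = g (pure2 N c n)"
  shows "f t = g t"
  using T.tensor_additive_eq [where f = f and g = g and T = P and t = t] assms by blast

lemma right_mult_ring:
  assumes [simp]: "u \<in> carrier MM" "v \<in> carrier MM" and t: "t \<in> carrier (tensor2 N)"
  shows "right_mult N (u \<oplus>\<^bsub>MM\<^esub> v) t = right_mult N u t \<oplus>\<^bsub>tensor2 N\<^esub> right_mult N v t"
    and "right_mult N (u \<otimes>\<^bsub>MM\<^esub> v) t = right_mult N v (right_mult N u t)"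
proof -
  note eqI = tensor2_additive_eq [where P = "tensor2 N", OF t]
  show "right_mult N (u \<oplus>\<^bsub>MM\<^esub> v) t = right_mult N u t \<oplus>\<^bsub>tensor2 N\<^esub> right_mult N v t"
    by (rule eqI) (simp_all add: right_mult ract1_ring MM_mod_add_ac)
  show "right_mult N (u \<otimes>\<^bsub>MM\<^esub> v) t = right_mult N v (right_mult N u t)"
    by (rule eqI) (simp_all add: right_mult ract1_ring)
qed

lemma right_mult_one: "t \<in> carrier (tensor2 N) \<Longrightarrow> right_mult N \<one>\<^bsub>MM\<^esub> t = t"
  by (rule tensor2_additive_eq [where P = "tensor2 N"]) (simp_all add: right_mult ract1_one)

lemma tensor2_hom_eqI:
  assumes "f \<in> lmod_hom MM (tensor2 N) P" "g \<in> lmod_hom MM (tensor2 N) P"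
    and "\<And>c n. \<lbrakk>c \<in> carrier MM2; n \<in> carrier N\<rbrakk> \<Longrightarrow> f (pure2 N c n) = g (pure2 N c n)"
  shows "f = g"
  by (rule lmod_hom_eqI [OF assms(1,2)], rule tensor2_additive_eq [where P = P])
    (simp_all add: lmod_hom_add [OF assms(1)] lmod_hom_add [OF assms(2)] assms(3))

context
  fixes P :: "(mat, 'p) module"
  assumes P [simp, intro]: "left_module MM P"
begin

interpretation P: left_module MM P by (rule P)

lemma ihom_smult_closed:
  assumes [simp]: "u \<in> carrier MM" and h: "h \<in> lmod_hom MM (tensor2 N) P"
  shows "(\<lambda>t\<in>carrier (tensor2 N). h (right_mult N u t)) \<in> lmod_hom MM (tensor2 N) P"
  by (rule lmod_homI) (simp_all add: right_mult lmod_homD [OF h])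

lemma left_module_ihom: "left_module MM (ihom N P)"
proof -
  note eqI = lmod_hom_eqI [where M = "tensor2 N" and N = P and R = MM]
  interpret MM: ring MM by (rule ring_MM)
  interpret abelian_group "ihom N P"
  proof (rule abelian_groupI; unfold ihom_simps)
    fix h k l assume h: "h \<in> lmod_hom MM (tensor2 N) P" and k: "k \<in> lmod_hom MM (tensor2 N) P"
      and l: "l \<in> lmod_hom MM (tensor2 N) P"
    note [simp] = h k l lmod_homD [OF h] lmod_homD [OF k] lmod_homD [OF l]
    show "hom_add (tensor2 N) P h k \<in> lmod_hom MM (tensor2 N) P"
      by simp
    show "hom_add (tensor2 N) P (hom_add (tensor2 N) P h k) l =
        hom_add (tensor2 N) P h (hom_add (tensor2 N) P k l)"
      by (rule eqI) (simp_all add: P.a_assoc)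
    show "hom_add (tensor2 N) P h k = hom_add (tensor2 N) P k h"
      by (rule eqI) (simp_all add: P.a_comm)
  next
    show zero: "(\<lambda>t\<in>carrier (tensor2 N). \<zero>\<^bsub>P\<^esub>) \<in> lmod_hom MM (tensor2 N) P"
      by (rule lmod_homI) (simp_all add: P.smult_zero)
    fix h assume h: "h \<in> lmod_hom MM (tensor2 N) P"
    note [simp] = h zero lmod_homD [OF h]
    show "hom_add (tensor2 N) P (\<lambda>t\<in>carrier (tensor2 N). \<zero>\<^bsub>P\<^esub>) h = h"
      by (rule eqI) simp_all
    have [simp]: "(\<lambda>t\<in>carrier (tensor2 N). \<ominus>\<^bsub>P\<^esub> h t) \<in> lmod_hom MM (tensor2 N) P"
      by (rule lmod_homI) (simp_all add: P.smult_a_inv P.minus_add P.a_comm)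
    have "hom_add (tensor2 N) P (\<lambda>t\<in>carrier (tensor2 N). \<ominus>\<^bsub>P\<^esub> h t) h =
        (\<lambda>t\<in>carrier (tensor2 N). \<zero>\<^bsub>P\<^esub>)"
      by (rule eqI) (simp_all add: P.l_neg)
    then show "\<exists>k\<in>lmod_hom MM (tensor2 N) P.
        hom_add (tensor2 N) P k h = (\<lambda>t\<in>carrier (tensor2 N). \<zero>\<^bsub>P\<^esub>)"
      by (intro bexI [of _ "\<lambda>t\<in>carrier (tensor2 N). \<ominus>\<^bsub>P\<^esub> h t"]) simp_all
  qed
  show ?thesis
  proof (unfold_locales; unfold ihom_simps)
    fix u v h k assume u [simp]: "u \<in> carrier MM" and v [simp]: "v \<in> carrier MM"
      and h: "h \<in> lmod_hom MM (tensor2 N) P" and k: "k \<in> lmod_hom MM (tensor2 N) P"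
    note [simp] = h k lmod_homD [OF h] lmod_homD [OF k] ihom_smult_closed
    show "(\<lambda>t\<in>carrier (tensor2 N). h (right_mult N u t)) \<in> lmod_hom MM (tensor2 N) P"
      by simp
    show "(\<lambda>t\<in>carrier (tensor2 N). h (right_mult N (u \<oplus>\<^bsub>MM\<^esub> v) t)) =
        hom_add (tensor2 N) P (\<lambda>t\<in>carrier (tensor2 N). h (right_mult N u t))
          (\<lambda>t\<in>carrier (tensor2 N). h (right_mult N v t))"
      by (rule eqI) (simp_all add: right_mult_ring right_mult)
    show "(\<lambda>t\<in>carrier (tensor2 N). hom_add (tensor2 N) P h k (right_mult N u t)) =
        hom_add (tensor2 N) P (\<lambda>t\<in>carrier (tensor2 N). h (right_mult N u t))
          (\<lambda>t\<in>carrier (tensor2 N). k (right_mult N u t))"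
      by (rule eqI) (simp_all add: right_mult)
    \<comment> \<open>Precomposing with a right action gives a left one: (u (v h)) (t) = h ((t u) v)
      = h (t (u v)).\<close>
    show "(\<lambda>t\<in>carrier (tensor2 N). h (right_mult N (u \<otimes>\<^bsub>MM\<^esub> v) t)) =
        (\<lambda>t\<in>carrier (tensor2 N). (\<lambda>t\<in>carrier (tensor2 N). h (right_mult N v t)) (right_mult N u t))"
      by (rule restrict_ext) (simp add: right_mult_ring right_mult)
  next
    fix h assume h: "h \<in> lmod_hom MM (tensor2 N) P"
    show "(\<lambda>t\<in>carrier (tensor2 N). h (right_mult N \<one>\<^bsub>MM\<^esub> t)) = h"
      by (rule eqI) (simp_all add: right_mult_one h ihom_smult_closed)
  qed
qed

end

end

declare left_module_ihom [simp, intro]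

section \<open>Functoriality of the internal Hom\<close>

lemma ihom_map_apply [simp]:
  assumes "h \<in> lmod_hom MM (tensor2 N) P"
  shows "ihom_map N P g h = compose (carrier (tensor2 N)) g h"
  using assms by (simp add: ihom_map_def ihom_simps)

lemma ihom_map_hom [simp, intro]:
  assumes [simp]: "left_module MM N" "left_module MM P" "left_module MM P'"
    and g: "g \<in> lmod_hom MM P P'"
  shows "ihom_map N P g \<in> lmod_hom MM (ihom N P) (ihom N P')"
proof -
  note eqI = lmod_hom_eqI [where M = "tensor2 N" and N = P' and R = MM]
  have comp [simp]: "compose (carrier (tensor2 N)) g h \<in> lmod_hom MM (tensor2 N) P'"
    if "h \<in> lmod_hom MM (tensor2 N) P" for h
    using that g by (intro left_module.lmod_hom_compose) auto
  show ?thesis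
  proof (rule lmod_homI; (unfold ihom_simps)?)
    show "ihom_map N P g \<in> extensional (lmod_hom MM (tensor2 N) P)"
      by (simp add: ihom_map_def ihom_simps)
    fix h k assume h: "h \<in> lmod_hom MM (tensor2 N) P" and k: "k \<in> lmod_hom MM (tensor2 N) P"
    note [simp] = h k lmod_homD [OF h] lmod_homD [OF k] lmod_homD [OF g]
    show "ihom_map N P g h \<in> lmod_hom MM (tensor2 N) P'"
      by simp
    show "ihom_map N P g (hom_add (tensor2 N) P h k) =
        hom_add (tensor2 N) P' (ihom_map N P g h) (ihom_map N P g k)"
      by (rule eqI) simp_all
  next
    fix h u assume h: "h \<in> lmod_hom MM (tensor2 N) P" and u [simp]: "u \<in> carrier MM"
    note [simp] = h lmod_homD [OF h] lmod_homD [OF g] ihom_smult_closed right_mult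
    show "ihom_map N P g (\<lambda>t\<in>carrier (tensor2 N). h (right_mult N u t)) =
        (\<lambda>t\<in>carrier (tensor2 N). ihom_map N P g h (right_mult N u t))"
      by (rule eqI) simp_all
  qed
qed

lemmas ihom_intros = hom_intros ihom_map_hom left_module_ihom left_module_tensor2

lemma ihom_map_id:
  assumes "left_module MM N" "left_module MM P"
  shows "ihom_map N P (lmod_id P) = lmod_id (ihom N P)"
proof (rule lmod_hom_eqI [where M = "ihom N P" and N = "ihom N P" and R = MM])
  fix h assume "h \<in> carrier (ihom N P)"
  then have h: "h \<in> lmod_hom MM (tensor2 N) P"
    by (simp add: ihom_simps)
  have "compose (carrier (tensor2 N)) (lmod_id P) h = h"
    by (rule lmod_hom_eqI [where M = "tensor2 N" and N = P and R = MM];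
        ((rule ihom_intros assms h)+)?)
      (simp add: lmod_hom_closed [OF h])
  then show "ihom_map N P (lmod_id P) h = lmod_id (ihom N P) h"
    using h by (simp add: ihom_simps)
qed (rule ihom_intros assms)+

lemma ihom_map_compose:
  assumes "left_module MM N" "left_module MM P" "left_module MM P'" "left_module MM P''"
    and g: "g \<in> lmod_hom MM P P'" and g': "g' \<in> lmod_hom MM P' P''"
  shows "ihom_map N P (compose (carrier P) g' g) =
    compose (carrier (ihom N P)) (ihom_map N P' g') (ihom_map N P g)"
proof (rule lmod_hom_eqI [where M = "ihom N P" and N = "ihom N P''" and R = MM])
  fix h assume "h \<in> carrier (ihom N P)"
  then have h: "h \<in> lmod_hom MM (tensor2 N) P"
    by (simp add: ihom_simps)
  have "compose (carrier (tensor2 N)) g h \<in> lmod_hom MM (tensor2 N) P'"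
    by (rule ihom_intros assms h)+
  then show "ihom_map N P (compose (carrier P) g' g) h =
      compose (carrier (ihom N P)) (ihom_map N P' g') (ihom_map N P g) h"
    using h by (simp add: ihom_simps compose_def lmod_hom_closed [OF h] cong: restrict_cong)
qed (rule ihom_intros assms)+

section \<open>Currying and the adjunction\<close>

context
  fixes M :: "(mat, 'm) module" and N :: "(mat, 'n) module" and P :: "(mat, 'p) module"
  assumes mods [simp, intro]: "left_module MM M" "left_module MM N" "left_module MM P"
begin

interpretation T: tensor_module MM MM ract2 MM2 N
  by (rule tensor_module_ract2 [OF mods(2)])
interpretation P: left_module MM P by (rule mods)

context
  fixes f
  assumes f: "f \<in> lmod_hom MM (M \<boxtimes> N) P"
begin

lemma balanced_curry:
  "m \<in> carrier M \<Longrightarrow> balanced MM ract2 MM2 N P (\<lambda>c n. f (ipure M N c m n))"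
  by (simp add: balanced_def lmod_homD [OF f])

lemmas curry_lift = T.lift_pure [OF P.M.abelian_group_axioms balanced_curry]
  T.lift_closed [OF P.M.abelian_group_axioms balanced_curry]
  T.lift_add [OF P.M.abelian_group_axioms balanced_curry]

lemma lmod_curry_pure:
  "\<lbrakk>m \<in> carrier M; c \<in> carrier MM2; n \<in> carrier N\<rbrakk> \<Longrightarrow>
    lmod_curry M N P f m (pure2 N c n) = f (ipure M N c m n)"
  by (simp add: lmod_curry_def curry_lift)

lemma lmod_curry_closed:
  assumes m: "m \<in> carrier M"
  shows "lmod_curry M N P f m \<in> lmod_hom MM (tensor2 N) P"
proof (rule lmod_homI)
  show closed: "lmod_curry M N P f m t \<in> carrier P" if "t \<in> carrier (tensor2 N)" for t
    using that m by (simp add: lmod_curry_def curry_lift)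
  show add: "lmod_curry M N P f m (s \<oplus>\<^bsub>tensor2 N\<^esub> t) =
      lmod_curry M N P f m s \<oplus>\<^bsub>P\<^esub> lmod_curry M N P f m t"
    if "s \<in> carrier (tensor2 N)" "t \<in> carrier (tensor2 N)" for s t
    using that m by (simp add: lmod_curry_def curry_lift)
  fix u t assume [simp]: "u \<in> carrier MM" and t: "t \<in> carrier (tensor2 N)"
  \<comment> \<open>Left scalars on an internal tensor product act on the cube alone, so linearity
    of f becomes linearity in c.\<close>
  have smult: "f (ipure M N (u \<odot>\<^bsub>MM2\<^esub> c) m n) = u \<odot>\<^bsub>P\<^esub> f (ipure M N c m n)"
    if "c \<in> carrier MM2" "n \<in> carrier N" for c n
    using lmod_hom_smult [OF f, of u "ipure M N c m n"] that m by simp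
  show "lmod_curry M N P f m (u \<odot>\<^bsub>tensor2 N\<^esub> t) = u \<odot>\<^bsub>P\<^esub> lmod_curry M N P f m t"
    by (rule tensor2_additive_eq [where P = P, OF mods(2) t])
      (simp_all add: lmod_curry_pure m add closed smult)
qed (simp add: lmod_curry_def m)

text \<open>A scalar u on m crosses the tensor sign and becomes \<open>ract1 c u\<close>, which is
  how u acts on \<open>ihom N P\<close>; the scalars of the internal Hom are those that make
  currying linear.\<close>

lemma lmod_curry_hom: "lmod_curry M N P f \<in> lmod_hom MM M (ihom N P)"
proof (rule lmod_homI; (unfold ihom_simps)?)
  note eqI = tensor2_hom_eqI [where N = N and P = P]
  show "lmod_curry M N P f \<in> extensional (carrier M)"
    by (simp add: lmod_curry_def)
  fix m m' assume [simp]: "m \<in> carrier M" "m' \<in> carrier M"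
  show "lmod_curry M N P f m \<in> lmod_hom MM (tensor2 N) P"
    by (simp add: lmod_curry_closed)
  show "lmod_curry M N P f (m \<oplus>\<^bsub>M\<^esub> m') =
      hom_add (tensor2 N) P (lmod_curry M N P f m) (lmod_curry M N P f m')"
    by (rule eqI) (simp_all add: lmod_curry_closed lmod_curry_pure lmod_homD [OF f])
  fix u assume [simp]: "u \<in> carrier MM"
  show "lmod_curry M N P f (u \<odot>\<^bsub>M\<^esub> m) =
      (\<lambda>t\<in>carrier (tensor2 N). lmod_curry M N P f m (right_mult N u t))"
    by (rule eqI)
      (simp_all add: lmod_curry_closed lmod_curry_pure right_mult ihom_smult_closed)
qed

end

text \<open>The inverse of currying. Balance in m comes from linearity of g and the scalars of
  \<open>ihom N P\<close>, balance in n from the tensor product \<open>MM2 \<otimes> N\<close>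
  itself.\<close>

definition lmod_uncurry :: "('m \<Rightarrow> (cube, 'n) tens \<Rightarrow> 'p) \<Rightarrow> ('m, 'n) itens \<Rightarrow> 'p"
  where "lmod_uncurry g = (\<lambda>t\<in>carrier (M \<boxtimes> N). ilift P (\<lambda>c m n. g m (pure2 N c n)) t)"

context
  fixes g
  assumes g: "g \<in> lmod_hom MM M (ihom N P)"
begin

lemma curried_hom: "m \<in> carrier M \<Longrightarrow> g m \<in> lmod_hom MM (tensor2 N) P"
  using lmod_hom_closed [OF g] by (simp add: ihom_simps)

lemmas curried_homD = lmod_homD [OF curried_hom]

lemma balanced3_uncurry: "balanced3 M N P (\<lambda>c m n. g m (pure2 N c n))"
  by (simp add: balanced3_def lmod_homD [OF g] curried_homD ihom_simps right_mult)

lemma lmod_uncurry_hom: "lmod_uncurry g \<in> lmod_hom MM (M \<boxtimes> N) P"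
  unfolding lmod_uncurry_def
  by (rule ilift_hom [OF _ _ _ balanced3_uncurry]) (simp_all add: curried_homD flip: pure2(5))

lemma lmod_uncurry_ipure:
  "\<lbrakk>c \<in> carrier MM2; m \<in> carrier M; n \<in> carrier N\<rbrakk> \<Longrightarrow>
    lmod_uncurry g (ipure M N c m n) = g m (pure2 N c n)"
  by (simp add: lmod_uncurry_def ilift_ipure [OF _ _ _ balanced3_uncurry])

end

text \<open>On generators the two constructions trade the value of f at
  \<open>ipure M N c m n\<close> for the value of g m at \<open>pure2 N c n\<close>, so each
  composite fixes the values that determine a linear map.\<close>

lemma bij_betw_lmod_curry:
  "bij_betw (lmod_curry M N P) (lmod_hom MM (M \<boxtimes> N) P) (lmod_hom MM M (ihom N P))"
proof (rule bij_betw_byWitness [where f' = lmod_uncurry])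
  show "\<forall>f\<in>lmod_hom MM (M \<boxtimes> N) P. lmod_uncurry (lmod_curry M N P f) = f"
  proof
    fix f assume f: "f \<in> lmod_hom MM (M \<boxtimes> N) P"
    show "lmod_uncurry (lmod_curry M N P f) = f"
      by (rule itensor_hom_eqI [where M = M and N = N and T = P])
        (simp_all add: f lmod_uncurry_hom lmod_curry_hom lmod_uncurry_ipure lmod_curry_pure)
  qed
  show "\<forall>g\<in>lmod_hom MM M (ihom N P). lmod_curry M N P (lmod_uncurry g) = g"
  proof
    fix g assume g: "g \<in> lmod_hom MM M (ihom N P)"
    show "lmod_curry M N P (lmod_uncurry g) = g"
    proof (rule lmod_hom_eqI [OF lmod_curry_hom [OF lmod_uncurry_hom [OF g]] g])
      fix m assume [simp]: "m \<in> carrier M"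
      show "lmod_curry M N P (lmod_uncurry g) m = g m"
        by (rule tensor2_hom_eqI [where N = N and P = P])
          (simp_all add: g lmod_uncurry_hom lmod_curry_closed curried_hom lmod_uncurry_ipure lmod_curry_pure)
    qed
  qed
qed (rule image_subsetI, erule lmod_curry_hom lmod_uncurry_hom)+

end

text \<open>At m and \<open>pure2 N c n\<close> both sides take the value of f at the pure element
  formed from c, a m and n.\<close>

lemma lmod_curry_natural_left:
  assumes [simp, intro]: "left_module MM M" "left_module MM M'" "left_module MM N" "left_module MM P"
    and a [simp, intro]: "a \<in> lmod_hom MM M M'" and f [simp, intro]: "f \<in> lmod_hom MM (M' \<boxtimes> N) P"
  shows "lmod_curry M N P (compose (carrier (M \<boxtimes> N)) f (itensor_map M M' N N a (lmod_id N))) =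
    compose (carrier M) (lmod_curry M' N P f) a"
proof (rule lmod_hom_eqI [where M = M and N = "ihom N P" and R = MM])
  note [simp] = lmod_homD [OF a]
  have fa [simp]: "compose (carrier (M \<boxtimes> N)) f (itensor_map M M' N N a (lmod_id N)) \<in> lmod_hom MM (M \<boxtimes> N) P"
    by (rule hom_intros assms)+
  show "lmod_curry M N P (compose (carrier (M \<boxtimes> N)) f (itensor_map M M' N N a (lmod_id N))) \<in>
      lmod_hom MM M (ihom N P)"
    by (simp add: lmod_curry_hom)
  show "compose (carrier M) (lmod_curry M' N P f) a \<in> lmod_hom MM M (ihom N P)"
    by (rule ihom_intros assms lmod_curry_hom)+
  fix m assume [simp]: "m \<in> carrier M"
  show "lmod_curry M N P (compose (carrier (M \<boxtimes> N)) f (itensor_map M M' N N a (lmod_id N))) m =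
      compose (carrier M) (lmod_curry M' N P f) a m"
    by (rule tensor2_hom_eqI [where N = N and P = P]) (simp_all add: lmod_curry_closed lmod_curry_pure)
qed

lemma lmod_curry_natural_right:
  assumes [simp, intro]: "left_module MM M" "left_module MM N" "left_module MM P" "left_module MM P'"
    and g [simp, intro]: "g \<in> lmod_hom MM P P'" and f [simp, intro]: "f \<in> lmod_hom MM (M \<boxtimes> N) P"
  shows "lmod_curry M N P' (compose (carrier (M \<boxtimes> N)) g f) =
    compose (carrier M) (ihom_map N P g) (lmod_curry M N P f)"
proof (rule lmod_hom_eqI [where M = M and N = "ihom N P'" and R = MM])
  have gf [simp]: "compose (carrier (M \<boxtimes> N)) g f \<in> lmod_hom MM (M \<boxtimes> N) P'"
    by (rule hom_intros assms)+
  show "lmod_curry M N P' (compose (carrier (M \<boxtimes> N)) g f) \<in> lmod_hom MM M (ihom N P')"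
    by (simp add: lmod_curry_hom)
  show "compose (carrier M) (ihom_map N P g) (lmod_curry M N P f) \<in> lmod_hom MM M (ihom N P')"
    by (rule ihom_intros assms lmod_curry_hom)+
  fix m assume m [simp]: "m \<in> carrier M"
  have [simp]: "compose (carrier (tensor2 N)) g (lmod_curry M N P f m) \<in> lmod_hom MM (tensor2 N) P'"
    by (rule ihom_intros assms lmod_curry_closed m)+
  show "lmod_curry M N P' (compose (carrier (M \<boxtimes> N)) g f) m =
      compose (carrier M) (ihom_map N P g) (lmod_curry M N P f) m"
    by (rule tensor2_hom_eqI [where N = N and P = P'])
      (simp_all add: lmod_curry_closed lmod_curry_pure)
qed

theorem theorem2p2:
  fixes M :: "(mat, 'm) module" and M' :: "(mat, 'm1) module" and M'' :: "(mat, 'm2) module"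
    and N :: "(mat, 'n) module" and N' :: "(mat, 'n1) module" and N'' :: "(mat, 'n2) module"
    and P :: "(mat, 'p) module" and P' :: "(mat, 'p1) module" and P'' :: "(mat, 'p2) module"
    and Q :: "(mat, 'q) module"
  assumes "left_module MM M" and "left_module MM M'" and "left_module MM M''"
    and "left_module MM N" and "left_module MM N'" and "left_module MM N''"
    and "left_module MM P" and "left_module MM P'" and "left_module MM P''"
    and "left_module MM Q"
  shows
    \<comment> \<open>the unit object, and the tensor product as a functor of two variables\<close>
    "left_module MM Zb \<and>
     left_module MM (M \<boxtimes> N) \<and>
     (\<forall>f\<in>lmod_hom MM M M'. \<forall>g\<in>lmod_hom MM N N'.
        itensor_map M M' N N' f g \<in> lmod_hom MM (M \<boxtimes> N) (M' \<boxtimes> N')) \<and>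
     itensor_map M M N N (lmod_id M) (lmod_id N) = lmod_id (M \<boxtimes> N) \<and>
     (\<forall>f\<in>lmod_hom MM M M'. \<forall>f'\<in>lmod_hom MM M' M''.
      \<forall>g\<in>lmod_hom MM N N'. \<forall>g'\<in>lmod_hom MM N' N''.
        itensor_map M M'' N N'' (compose (carrier M) f' f) (compose (carrier N) g' g) =
        compose (carrier (M \<boxtimes> N)) (itensor_map M' M'' N' N'' f' g') (itensor_map M M' N N' f g)) \<and>

     \<comment> \<open>additivity in each variable\<close>
     (\<forall>f\<in>lmod_hom MM M M'. \<forall>f'\<in>lmod_hom MM M M'. \<forall>g\<in>lmod_hom MM N N'.
        itensor_map M M' N N' (hom_add M M' f f') g =
        hom_add (M \<boxtimes> N) (M' \<boxtimes> N') (itensor_map M M' N N' f g) (itensor_map M M' N N' f' g)) \<and>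
     (\<forall>f\<in>lmod_hom MM M M'. \<forall>g\<in>lmod_hom MM N N'. \<forall>g'\<in>lmod_hom MM N N'.
        itensor_map M M' N N' f (hom_add N N' g g') =
        hom_add (M \<boxtimes> N) (M' \<boxtimes> N') (itensor_map M M' N N' f g) (itensor_map M M' N N' f g')) \<and>

     \<comment> \<open>the structural maps are isomorphisms\<close>
     lunit M \<in> lmod_iso MM (Zb \<boxtimes> M) M \<and>
     runit M \<in> lmod_iso MM (M \<boxtimes> Zb) M \<and>
     braid M N \<in> lmod_iso MM (M \<boxtimes> N) (N \<boxtimes> M) \<and>
     assoc M N P \<in> lmod_iso MM ((M \<boxtimes> N) \<boxtimes> P) (M \<boxtimes> (N \<boxtimes> P)) \<and>

     \<comment> \<open>the structural maps are natural\<close>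
     (\<forall>f\<in>lmod_hom MM M M'.
        compose (carrier (Zb \<boxtimes> M)) f (lunit M) =
        compose (carrier (Zb \<boxtimes> M)) (lunit M') (itensor_map Zb Zb M M' (lmod_id Zb) f)) \<and>
     (\<forall>f\<in>lmod_hom MM M M'.
        compose (carrier (M \<boxtimes> Zb)) f (runit M) =
        compose (carrier (M \<boxtimes> Zb)) (runit M') (itensor_map M M' Zb Zb f (lmod_id Zb))) \<and>
     (\<forall>f\<in>lmod_hom MM M M'. \<forall>g\<in>lmod_hom MM N N'.
        compose (carrier (M \<boxtimes> N)) (itensor_map N N' M M' g f) (braid M N) =
        compose (carrier (M \<boxtimes> N)) (braid M' N') (itensor_map M M' N N' f g)) \<and>
     (\<forall>f\<in>lmod_hom MM M M'. \<forall>g\<in>lmod_hom MM N N'. \<forall>h\<in>lmod_hom MM P P'.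
        compose (carrier ((M \<boxtimes> N) \<boxtimes> P))
          (itensor_map M M' (N \<boxtimes> P) (N' \<boxtimes> P') f (itensor_map N N' P P' g h)) (assoc M N P) =
        compose (carrier ((M \<boxtimes> N) \<boxtimes> P))
          (assoc M' N' P') (itensor_map (M \<boxtimes> N) (M' \<boxtimes> N') P P' (itensor_map M M' N N' f g) h)) \<and>

     \<comment> \<open>pentagon\<close>
     compose (carrier (((M \<boxtimes> N) \<boxtimes> P) \<boxtimes> Q)) (assoc M N (P \<boxtimes> Q)) (assoc (M \<boxtimes> N) P Q) =
     compose (carrier (((M \<boxtimes> N) \<boxtimes> P) \<boxtimes> Q))
       (itensor_map M M ((N \<boxtimes> P) \<boxtimes> Q) (N \<boxtimes> (P \<boxtimes> Q)) (lmod_id M) (assoc N P Q))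
       (compose (carrier (((M \<boxtimes> N) \<boxtimes> P) \<boxtimes> Q))
         (assoc M (N \<boxtimes> P) Q)
         (itensor_map ((M \<boxtimes> N) \<boxtimes> P) (M \<boxtimes> (N \<boxtimes> P)) Q Q (assoc M N P) (lmod_id Q))) \<and>

     \<comment> \<open>triangle\<close>
     compose (carrier ((M \<boxtimes> Zb) \<boxtimes> N))
       (itensor_map M M (Zb \<boxtimes> N) N (lmod_id M) (lunit N)) (assoc M Zb N) =
     itensor_map (M \<boxtimes> Zb) M N N (runit M) (lmod_id N) \<and>

     \<comment> \<open>symmetry and hexagon\<close>
     compose (carrier (M \<boxtimes> N)) (braid N M) (braid M N) = lmod_id (M \<boxtimes> N) \<and>
     compose (carrier ((M \<boxtimes> N) \<boxtimes> P))
       (assoc N P M)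
       (compose (carrier ((M \<boxtimes> N) \<boxtimes> P)) (braid M (N \<boxtimes> P)) (assoc M N P)) =
     compose (carrier ((M \<boxtimes> N) \<boxtimes> P))
       (itensor_map N N (M \<boxtimes> P) (P \<boxtimes> M) (lmod_id N) (braid M P))
       (compose (carrier ((M \<boxtimes> N) \<boxtimes> P))
         (assoc N M P)
         (itensor_map (M \<boxtimes> N) (N \<boxtimes> M) P P (braid M N) (lmod_id P))) \<and>

     \<comment> \<open>the functor \<open>ihom N\<close>, right adjoint to \<open>- \<boxtimes> N\<close>\<close>
     left_module MM (ihom N P) \<and>
     (\<forall>g\<in>lmod_hom MM P P'. ihom_map N P g \<in> lmod_hom MM (ihom N P) (ihom N P')) \<and>
     ihom_map N P (lmod_id P) = lmod_id (ihom N P) \<and>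
     (\<forall>g\<in>lmod_hom MM P P'. \<forall>g'\<in>lmod_hom MM P' P''.
        ihom_map N P (compose (carrier P) g' g) =
        compose (carrier (ihom N P)) (ihom_map N P' g') (ihom_map N P g)) \<and>
     bij_betw (lmod_curry M N P) (lmod_hom MM (M \<boxtimes> N) P) (lmod_hom MM M (ihom N P)) \<and>
     (\<forall>a\<in>lmod_hom MM M M'. \<forall>f\<in>lmod_hom MM (M' \<boxtimes> N) P.
        lmod_curry M N P (compose (carrier (M \<boxtimes> N)) f (itensor_map M M' N N a (lmod_id N))) =
        compose (carrier M) (lmod_curry M' N P f) a) \<and>
     (\<forall>g\<in>lmod_hom MM P P'. \<forall>f\<in>lmod_hom MM (M \<boxtimes> N) P.
        lmod_curry M N P' (compose (carrier (M \<boxtimes> N)) g f) =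
        compose (carrier M) (ihom_map N P g) (lmod_curry M N P f))"
  using assms
  by (intro conjI ballI)
    (rule left_module_Zb left_module_itensor itensor_map_hom itensor_map_id itensor_map_compose
        itensor_map_add1 itensor_map_add2 lunit_iso runit_iso braid_iso assoc_iso
        lunit_natural runit_natural braid_natural assoc_natural pentagon triangle braid_braid hexagon
        left_module_ihom ihom_map_hom ihom_map_id ihom_map_compose bij_betw_lmod_curry
        lmod_curry_natural_left lmod_curry_natural_right;
      assumption)+

end
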